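(* Let $p\equiv3\pmod 4$ be a prime, $R\ge 2$ an even integer, and $h$ an odd positive integer with $2h\mid(p-1)$. Then $\mathrm{GPaley}(p^R,\frac{p^R-1}{2h})\not\cong\mathrm{TGPaley}(p^R,\frac{p^R-1}{2h})$, except in the case $(R,p,h)=(2,3,1)$, where $\mathrm{GPaley}(3^2,4)\cong\mathrm{TGPaley}(3^2,4)$.
   Context: Let $V=\mathbb{F}_{p^R}$ with a primitive element $\omega$; $\mathrm{Cay}(V,S)$ has vertex set $V$ and edges $\{u,v\}$ with $v-u\in S$. For $k\mid p^R-1$ (with $\frac{p^R-1}{k}$ even when $p$ is odd), $\mathrm{GPaley}(p^R,\frac{p^R-1}{k})=\mathrm{Cay}(V,\{\omega^{jk}:j\ge0\})$. For $R$ even, $p\equiv3\pmod4$ and $h$ odd with $2h\mid p-1$, with $S_0=\{\omega^{4hj}:j\ge0\}$, the twisted generalised Paley graph is $\mathrm{TGPaley}(p^R,\frac{p^R-1}{2h})=\mathrm{Cay}(V,S_0\cup\omega^{3h}S_0)$. *)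

theory Defs
  imports "HOL-Library.Cardinality" "HOL-Computational_Algebra.Primes" "HOL-Number_Theory.Cong"
begin

record 'a ugraph =
  vertices :: "'a set"
  edges :: "'a set set"

definition ugraph_iso :: "'a ugraph \<Rightarrow> 'b ugraph \<Rightarrow> bool" where
  "ugraph_iso G H \<longleftrightarrow>
     (\<exists>f. bij_betw f (vertices G) (vertices H) \<and>
          (\<forall>u\<in>vertices G. \<forall>v\<in>vertices G. {u, v} \<in> edges G \<longleftrightarrow> {f u, f v} \<in> edges H))"

definition Cay :: "'a::ab_group_add set \<Rightarrow> 'a ugraph" where
  "Cay S = \<lparr>vertices = UNIV, edges = {{u, v} |u v. v - u \<in> S}\<rparr>"

definition primitive_element :: "'a::field \<Rightarrow> bool" where
  "primitive_element \<omega> \<longleftrightarrow> range (\<lambda>j::nat. \<omega> ^ j) = UNIV - {0}"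

text \<open>
  With \<open>q\<close> the order of the field \<open>'a\<close>, \<open>GPaley \<omega> k\<close> is the graph usually written
  \<open>GPaley(q, (q - 1) / k)\<close>, and \<open>TGPaley \<omega> h\<close> is \<open>TGPaley(q, (q - 1) / (2h))\<close>:
  the parameters here are the index \<open>k\<close> and the half-index \<open>h\<close>, not the valency.
\<close>

definition GPaley :: "'a::field \<Rightarrow> nat \<Rightarrow> 'a ugraph" where
  "GPaley \<omega> k = Cay {\<omega> ^ (j * k) |j::nat. True}"

definition TGPaley :: "'a::field \<Rightarrow> nat \<Rightarrow> 'a ugraph" where
  "TGPaley \<omega> h =
     (let S\<^sub>0 = {\<omega> ^ (4 * h * j) |j::nat. True}
      in Cay (S\<^sub>0 \<union> (\<lambda>s. \<omega> ^ (3 * h) * s) ` S\<^sub>0))"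

end

theory Submission
  imports Defs "HOL-Computational_Algebra.Polynomial"
begin

text \<open>
  For a connection set \<open>S\<close> let \<open>T\<close> be the operator
  \<open>(T \<phi>)(x) = (\<Sum>s\<in>S. \<phi> (x + s)) - |S| * \<phi> x\<close> on functions from the field to itself, i.e. the
  adjacency matrix minus the valency, reduced modulo \<open>p\<close>.  Graph isomorphisms intertwine these
  operators.  On monomials, \<open>T\<close> sends \<open>x ^ a\<close> to a combination of those \<open>x ^ (a - j)\<close>, \<open>j > 0\<close>, for
  which the power sum of \<open>S\<close> of exponent \<open>j\<close> is nonzero and, by Lucas, the \<open>p\<close>-adic digits of \<open>j\<close>
  are dominated by those of \<open>a\<close>.

  If \<open>h \<ge> 3\<close>, the digit patterns show that \<open>T ^ (2h)\<close> is nonzero for the generalised Paley graph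
  (it maps \<open>x ^ (q - 1)\<close> to a nonzero constant) but zero for the twisted one.

  If \<open>h = 1\<close>, the image of \<open>T\<close> for the Paley graph is spanned by the monomials all of whose
  exponent digits are at most \<open>(p - 1) / 2\<close>, while the image for the twisted graph contains many
  monomials \<open>x ^ l\<close>.  For an isomorphism \<open>f\<close> from the former to the latter all these powers \<open>f ^ l\<close>
  lie in the former image, and comparing leading exponents forces \<open>f\<close> to be constant (\<open>R \<ge> 4\<close>), or
  \<open>f\<close> or \<open>f ^ p\<close> to be affine (\<open>R = 2\<close>, \<open>p > 3\<close>), which is impossible since the twisted connection
  set is not a multiple of the group of squares.
\<close>

subsection \<open>Binomial coefficients in characteristic \<open>p\<close>\<close>

lemma coeff_monic_linear_power:
  "coeff ([:a, 1:] ^ n) i = (of_nat (n choose i) * a ^ (n - i) :: 'a::comm_semiring_1)"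
proof (cases "i \<le> n")
  case False
  have "degree ([:a, 1:] ^ n :: 'a poly) \<le> degree [:a, 1:] * n" by (rule degree_power_le)
  with False show ?thesis by (simp add: coeff_eq_0 binomial_eq_0)
qed (simp add: coeff_linear_poly_power)

text \<open>Compare coefficients of \<open>X ^ b\<close> in
  \<open>(1 + X) ^ a = (1 + X ^ p) ^ (a div p) * (1 + X) ^ (a mod p)\<close>. The second factor has
  degree below \<open>p\<close>, so only \<open>k = b div p\<close> contributes.\<close>

lemma lucas_step:
  fixes a b p :: nat
  assumes "prime p" and char: "CHAR('a::idom) = p"
  shows "(of_nat (a choose b) :: 'a)
           = of_nat (a div p choose b div p) * of_nat (a mod p choose b mod p)"
proof -
  have p0: "p > 0" using assms prime_gt_0_nat by blast
  let ?Q = "[:1, 1:] ^ (a mod p) :: 'a poly"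
  have cQ: "coeff ?Q i = of_nat (a mod p choose i)" for i
    by (simp add: coeff_monic_linear_power)
  have "[:1, 1:] ^ p = (monom 1 1 + 1 :: 'a poly) ^ p"
    by (simp add: monom_altdef one_pCons)
  also have "\<dots> = monom 1 1 ^ p + 1 ^ p"
    using assms by (intro freshmans_dream) simp_all
  finally have frob: "[:1, 1:] ^ p = (monom 1 p + 1 :: 'a poly)"
    by (simp add: monom_power)
  have "[:1, 1:] ^ a = ([:1, 1:] ^ p) ^ (a div p) * ?Q"
    by (simp flip: power_mult power_add)
  also have "([:1, 1:] ^ p) ^ (a div p)
      = (\<Sum>k\<le>a div p. monom (of_nat (a div p choose k)) (p * k) :: 'a poly)"
    by (simp add: frob binomial_ring monom_power of_nat_monom mult_monom)
  finally have "of_nat (a choose b)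
      = coeff ((\<Sum>k\<le>a div p. monom (of_nat (a div p choose k)) (p * k)) * ?Q) b"
    by (metis coeff_monic_linear_power mult.right_neutral power_one)
  also have "\<dots> = (\<Sum>k\<le>a div p. of_nat (a div p choose k) *
                    (if p * k \<le> b then coeff ?Q (b - p * k) else 0))"
    by (auto simp: sum_distrib_right coeff_sum coeff_monom_mult intro!: sum.cong)
  also have "\<dots> = (\<Sum>k\<le>a div p. if k = b div p then
                    of_nat (a div p choose k) * of_nat (a mod p choose b mod p) else 0)"
  proof (rule sum.cong)
    fix k
    show "of_nat (a div p choose k) * (if p * k \<le> b then coeff ?Q (b - p * k) else 0)
        = (if k = b div p then of_nat (a div p choose k) * of_nat (a mod p choose b mod p) else 0)"
    proof (cases "k = b div p")
      case True
      then show ?thesis by (simp add: cQ minus_mult_div_eq_mod)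
    next
      case False
      have "coeff ?Q (b - p * k) = 0" if "p * k \<le> b"
      proof -
        have "k \<le> b div p" using that p0 by (simp add: less_eq_div_iff_mult_less_eq mult.commute)
        hence "p * (k + 1) \<le> p * (b div p)" using False by (intro mult_left_mono) auto
        hence "p \<le> b - p * k" using that by (simp add: algebra_simps) (metis add.commute add_leD1 le_diff_conv2 times_div_less_eq_dividend order_trans)
        hence "a mod p < b - p * k" using p0 by (meson mod_less_divisor order_less_le_trans)
        thus ?thesis by (simp add: cQ binomial_eq_0)
      qed
      with False show ?thesis by simp
    qed
  qed simp
  also have "\<dots> = of_nat (a div p choose b div p) * of_nat (a mod p choose b mod p)"
    by (auto simp: sum.delta binomial_eq_0)
  finally show ?thesis .
qed

lemma of_nat_choose_nonzero:
  assumes "prime p" "CHAR('a::idom) = p" "b \<le> a" "a < p"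
  shows "(of_nat (a choose b) :: 'a) \<noteq> 0"
proof
  assume "of_nat (a choose b) = (0 :: 'a)"
  hence "p dvd (a choose b)" using assms by (simp add: of_nat_eq_0_iff_char_dvd)
  also have "(a choose b) dvd fact a" using assms(3) binomial_fact_lemma[of b a] by (metis dvd_triv_right)
  finally show False using assms by (simp add: prime_dvd_fact_iff)
qed

text \<open>By Lucas, \<open>a - b\<close> borrows nothing in the lowest digit. The second
  conclusion allows the argument to be repeated on the quotients, digit by digit.\<close>

lemma choose_nonzeroD:
  assumes "prime p" "CHAR('a::idom) = p" "(of_nat (a choose b) :: 'a) \<noteq> 0"
  shows "b mod p \<le> a mod p" "(of_nat (a div p choose b div p) :: 'a) \<noteq> 0"
    "(a - b) mod p = a mod p - b mod p" "(a - b) div p = a div p - b div p" "b \<le> a"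
proof -
  have *: "(of_nat (a mod p choose b mod p) :: 'a) \<noteq> 0" "(of_nat (a div p choose b div p) :: 'a) \<noteq> 0"
    using assms(3) lucas_step[OF assms(1,2), of a b] by auto
  show 1: "b mod p \<le> a mod p" using * by (metis binomial_eq_0 linorder_not_less of_nat_0)
  show 2: "(of_nat (a div p choose b div p) :: 'a) \<noteq> 0" using * by simp
  have le: "b div p \<le> a div p" using * by (metis binomial_eq_0 linorder_not_less of_nat_0)
  show "b \<le> a" using assms(3) by (metis binomial_eq_0 linorder_not_less of_nat_0)
  have p0: "p > 0" using assms prime_gt_0_nat by blast
  have "a - b = p * (a div p - b div p) + (a mod p - b mod p)"
    using le 1 by (metis (no_types, lifting) diff_mult_distrib2 mult_div_mod_eq Nat.add_diff_assoc
      Nat.add_diff_assoc2 diff_diff_left mult_le_mono2)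
  moreover have "a mod p - b mod p < p" using p0 by (simp add: less_imp_diff_less)
  ultimately show "(a - b) mod p = a mod p - b mod p" "(a - b) div p = a div p - b div p"
    using p0 by (metis mod_mult_self4 mod_less mult.commute add.commute mod_mult_self2, metis div_mult_self4 div_less add.right_neutral mult.commute add.commute less_numeral_extra(3))
qed

subsection \<open>The shift operator of a connection set\<close>

definition shift_sum :: "'a::comm_ring_1 set \<Rightarrow> ('a \<Rightarrow> 'a) \<Rightarrow> 'a \<Rightarrow> 'a" where
  "shift_sum S \<phi> x = (\<Sum>s\<in>S. \<phi> (x + s)) - of_nat (card S) * \<phi> x"

text \<open>Formal counterpart of \<open>shift_sum\<close>, without reduction modulo
  \<open>X ^ q - X\<close>. Degrees never grow under it, so polynomials of degree below
  \<open>q\<close> keep representing functions uniquely.\<close>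

definition poly_shift_sum :: "'a::comm_ring_1 set \<Rightarrow> 'a poly \<Rightarrow> 'a poly" where
  "poly_shift_sum S P = (\<Sum>s\<in>S. P \<circ>\<^sub>p [:s, 1:]) - smult (of_nat (card S)) P"

lemma poly_poly_shift_sum: "poly (poly_shift_sum S P) = shift_sum S (poly P)"
  by (rule ext) (simp add: poly_shift_sum_def shift_sum_def poly_sum poly_pcompose add.commute)

lemma pcompose_power: "(P ^ n) \<circ>\<^sub>p Q = (P \<circ>\<^sub>p Q) ^ n"
  for P :: "'a::comm_semiring_1 poly"
  by (induction n) (simp_all add: pcompose_1 pcompose_mult)

text \<open>Expand each \<open>(X + s) ^ a\<close> binomially. The term \<open>a = b\<close> cancels
  against the subtracted multiple of \<open>P\<close>, so every surviving transition strictly lowers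
  the exponent.\<close>

lemma coeff_poly_shift_sum:
  fixes P :: "'a::idom poly"
  assumes "degree P \<le> n"
  shows "coeff (poly_shift_sum S P) b
     = (\<Sum>a\<in>{b<..n}. coeff P a * of_nat (a choose b) * (\<Sum>s\<in>S. s ^ (a - b)))"
proof -
  have P: "P = (\<Sum>a\<le>n. monom (coeff P a) a)"
    using assms by (simp add: poly_as_sum_of_monoms')
  have c: "coeff (P \<circ>\<^sub>p [:s, 1:]) b = (\<Sum>a\<le>n. coeff P a * of_nat (a choose b) * s ^ (a - b))" for s
  proof -
    have "coeff (P \<circ>\<^sub>p [:s, 1:]) b = (\<Sum>a\<le>n. coeff (smult (coeff P a) ([:s, 1:] ^ a)) b)"
      by (subst P) (simp add: pcompose_sum coeff_sum monom_altdef pcompose_smult pcompose_power pcompose_pCons)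
    also have "\<dots> = (\<Sum>a\<le>n. coeff P a * of_nat (a choose b) * s ^ (a - b))"
      by (simp add: coeff_monic_linear_power algebra_simps)
    finally show ?thesis .
  qed
  have "coeff (poly_shift_sum S P) b
      = (\<Sum>a\<le>n. coeff P a * of_nat (a choose b) * (\<Sum>s\<in>S. s ^ (a - b))) - of_nat (card S) * coeff P b"
    unfolding poly_shift_sum_def by (simp add: coeff_sum c sum_distrib_left) (subst sum.swap, simp)
  also have "(\<Sum>a\<le>n. coeff P a * of_nat (a choose b) * (\<Sum>s\<in>S. s ^ (a - b)))
      = (\<Sum>a\<in>{b..n}. coeff P a * of_nat (a choose b) * (\<Sum>s\<in>S. s ^ (a - b)))"
    by (rule sum.mono_neutral_right) (auto simp: binomial_eq_0)
  also have "\<dots> - of_nat (card S) * coeff P b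
      = (\<Sum>a\<in>{b<..n}. coeff P a * of_nat (a choose b) * (\<Sum>s\<in>S. s ^ (a - b)))"
  proof (cases "b \<le> n")
    case True
    then show ?thesis by (subst sum.head) (auto simp: mult.commute)
  next
    case False
    hence "coeff P b = 0" using assms by (simp add: coeff_eq_0)
    then show ?thesis using False by simp
  qed
  finally show ?thesis .
qed

lemma degree_poly_shift_sum_le: "degree (poly_shift_sum S P) \<le> degree (P :: 'a::idom poly)"
  by (rule degree_le) (auto simp: coeff_poly_shift_sum[OF order_refl])

section \<open>Graph isomorphisms and the shift operators\<close>

lemma edge_Cay_iff:
  assumes "\<And>x. x \<in> S \<Longrightarrow> - x \<in> S"
  shows "{u, v} \<in> edges (Cay S) \<longleftrightarrow> v - u \<in> S"
  using assms[of "v - u"] assms[of "u - v"] by (auto simp: Cay_def doubleton_eq_iff)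

lemma ugraph_iso_Cay_iff:
  assumes "\<And>x. x \<in> S \<Longrightarrow> - x \<in> S" "\<And>x. x \<in> S' \<Longrightarrow> - x \<in> S'"
  shows "ugraph_iso (Cay S) (Cay S') \<longleftrightarrow>
    (\<exists>f. bij f \<and> (\<forall>u v. v - u \<in> S \<longleftrightarrow> f v - f u \<in> S'))"
proof -
  have "vertices (Cay S) = UNIV" "vertices (Cay S') = UNIV" by (simp_all add: Cay_def)
  thus ?thesis
    unfolding ugraph_iso_def using edge_Cay_iff[of S, OF assms(1)] edge_Cay_iff[of S', OF assms(2)]
    by simp
qed

lemma shift_sum_iso:
  fixes f :: "'a::{comm_ring_1,finite} \<Rightarrow> 'a"
  assumes "bij f" and iso: "\<And>u v. v - u \<in> S \<longleftrightarrow> f v - f u \<in> S'"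
  shows "shift_sum S' \<phi> \<circ> f = shift_sum S (\<phi> \<circ> f)"
proof
  fix x
  \<comment> \<open>An isomorphism carries the neighbours of \<open>x\<close> to those of
    \<open>f x\<close>; in terms of differences this is a bijection from \<open>S\<close> to
    \<open>S'\<close>, which also equates the valencies.\<close>
  have bij: "bij_betw (\<lambda>s. f (x + s) - f x) S S'"
  proof (rule bij_betw_byWitness[where f' = "\<lambda>t. inv f (f x + t) - x"])
    show "\<forall>s\<in>S. inv f (f x + (f (x + s) - f x)) - x = s"
      using assms(1) by (simp add: bij_is_inj)
    show "\<forall>t\<in>S'. f (x + (inv f (f x + t) - x)) - f x = t"
      using assms(1) by (simp add: bij_is_surj surj_f_inv_f)
    show "(\<lambda>s. f (x + s) - f x) ` S \<subseteq> S'" using iso[of "x + _" x] by auto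
    show "(\<lambda>t. inv f (f x + t) - x) ` S' \<subseteq> S"
      using iso[of "inv f (f x + _)" x] assms(1) by (auto simp: bij_is_surj surj_f_inv_f)
  qed
  show "(shift_sum S' \<phi> \<circ> f) x = shift_sum S (\<phi> \<circ> f) x"
    using bij_betw_same_card[OF bij] sum.reindex_bij_betw[OF bij, of "\<lambda>t. \<phi> (f x + t)"]
    by (simp add: shift_sum_def)
qed

lemma shift_sum_funpow_iso:
  fixes f :: "'a::{comm_ring_1,finite} \<Rightarrow> 'a"
  assumes "bij f" "\<And>u v. v - u \<in> S \<longleftrightarrow> f v - f u \<in> S'"
  shows "(shift_sum S' ^^ n) \<phi> \<circ> f = (shift_sum S ^^ n) (\<phi> \<circ> f)"
proof (induction n)
  case (Suc n)
  have "(shift_sum S' ^^ Suc n) \<phi> \<circ> f = shift_sum S' ((shift_sum S' ^^ n) \<phi>) \<circ> f" by simp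
  also have "\<dots> = shift_sum S ((shift_sum S' ^^ n) \<phi> \<circ> f)" by (rule shift_sum_iso[OF assms])
  finally show ?case by (simp only: Suc funpow.simps o_apply)
qed simp

lemma poly_funpow_shift_sum: "poly ((poly_shift_sum S ^^ n) P) = (shift_sum S ^^ n) (poly P)"
  by (induction n) (simp_all add: poly_poly_shift_sum)

subsection \<open>Fields with a primitive element\<close>

locale primitive_field =
  fixes p R :: nat and \<omega> :: "'a::{field,finite}"
  assumes prime: "prime p" and R_pos: "R > 0"
    and card: "CARD('a) = p ^ R" and prim: "primitive_element \<omega>"
begin

abbreviation "q \<equiv> p ^ R"

lemma p_gt_1: "p > 1" using prime prime_gt_1_nat by blast

lemma q_gt_1: "q > 1" using p_gt_1 R_pos by (rule one_less_power)

lemma char: "CHAR('a) = p"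
proof -
  \<comment> \<open>Translation by 1 permutes the field, yet changes the sum of all elements by
    \<open>q\<close>, so \<open>q\<close> vanishes in the field.\<close>
  have "(\<Sum>x\<in>UNIV. x + 1 :: 'a) = (\<Sum>x\<in>UNIV. x)"
    by (rule sum.reindex_bij_witness[of _ "\<lambda>x. x - 1" "\<lambda>x. x + 1"]) auto
  hence "of_nat q = (0 :: 'a)" by (simp add: sum.distrib card)
  hence dvd: "CHAR('a) dvd q" by (simp only: of_nat_eq_0_iff_char_dvd)
  have "prime CHAR('a)" by (intro prime_CHAR_semidom finite_imp_CHAR_pos) simp
  thus ?thesis using dvd prime by (meson prime_dvd_power primes_dvd_imp_eq)
qed

lemma frobenius_add: "(x + y) ^ p = x ^ p + y ^ p" for x y :: 'a
  by (rule freshmans_dream) (simp_all add: char prime)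

lemma of_nat_eq_0_iff: "of_nat n = (0 :: 'a) \<longleftrightarrow> p dvd n"
  by (simp add: of_nat_eq_0_iff_char_dvd char)

lemma prim_nonzero: "\<omega> \<noteq> 0"
proof -
  have "\<omega> ^ 1 \<in> range (\<lambda>j. \<omega> ^ j)" by blast
  thus ?thesis using prim by (auto simp: primitive_element_def)
qed

text \<open>The powers below the least positive exponent \<open>d\<close> with
  \<open>\<omega> ^ d = 1\<close> are distinct and exhaust the nonzero elements, whence
  \<open>d = q - 1\<close>.\<close>

lemma prim_power_eq_1_iff: "\<omega> ^ n = 1 \<longleftrightarrow> (q - 1) dvd n"
proof -
  have "\<not> inj (\<lambda>j::nat. \<omega> ^ j)" using finite_imageD[of "\<lambda>j::nat. \<omega> ^ j" UNIV] by auto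
  then obtain i j :: nat where "i \<noteq> j" "\<omega> ^ i = \<omega> ^ j" unfolding inj_def by auto
  then obtain i j :: nat where ij: "i < j" "\<omega> ^ i = \<omega> ^ j" by (metis linorder_neqE_nat)
  hence "\<omega> ^ i * \<omega> ^ (j - i) = \<omega> ^ i" by (metis le_add_diff_inverse less_imp_le power_add)
  hence "j - i > 0 \<and> \<omega> ^ (j - i) = 1" using ij prim_nonzero by simp
  hence ex: "\<exists>n. n > 0 \<and> \<omega> ^ n = 1" by blast
  define d where "d = (LEAST n. n > 0 \<and> \<omega> ^ n = 1)"
  have d: "d > 0" "\<omega> ^ d = 1" using LeastI_ex[OF ex] by (auto simp: d_def)
  have min: "\<omega> ^ m \<noteq> 1" if "0 < m" "m < d" for m
    using not_less_Least[of m "\<lambda>n. n > 0 \<and> \<omega> ^ n = 1"] that by (auto simp: d_def)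
  have mod: "\<omega> ^ m = \<omega> ^ (m mod d)" for m
    by (metis d(2) mod_mult_div_eq mult.right_neutral power_add power_mult power_one)
  have "inj_on (\<lambda>j. \<omega> ^ j) {..<d}"
  proof (rule linorder_inj_onI')
    fix i j assume ij: "i \<in> {..<d}" "j \<in> {..<d}" "i < j"
    have "\<omega> ^ j = \<omega> ^ i * \<omega> ^ (j - i)" using ij by (simp flip: power_add)
    thus "\<omega> ^ i \<noteq> \<omega> ^ j" using min[of "j - i"] ij prim_nonzero by auto
  qed
  moreover have "range (\<lambda>j. \<omega> ^ j) = (\<lambda>j. \<omega> ^ j) ` {..<d}"
    using d(1) by (auto simp: image_iff) (metis lessThan_iff mod mod_less_divisor)
  ultimately have "d = card (UNIV - {0 :: 'a})"
    using prim by (metis card_image card_lessThan primitive_element_def)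
  hence "d = q - 1" by (simp add: card)
  moreover have "\<omega> ^ n = 1 \<longleftrightarrow> d dvd n"
    using min[of "n mod d"] mod[of n] d by (cases "n mod d = 0") (auto simp: dvd_eq_mod_eq_0)
  ultimately show ?thesis by simp
qed

lemma power_q_minus_1: "x \<noteq> 0 \<Longrightarrow> x ^ (q - 1) = 1" for x :: 'a
proof -
  assume "x \<noteq> 0"
  then obtain j where "x = \<omega> ^ j" using prim by (auto simp: primitive_element_def)
  hence "x ^ (q - 1) = \<omega> ^ (j * (q - 1))" by (simp flip: power_mult)
  thus ?thesis by (simp add: prim_power_eq_1_iff del: power_mult)
qed

lemma power_q: "x ^ q = x" for x :: 'a
  using power_q_minus_1[of x] q_gt_1 R_pos p_gt_1
  by (cases "x = 0") (auto simp: power_eq_if[of x q])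

lemma interpolation: "\<exists>P. degree P < q \<and> poly P = \<phi>" for \<phi> :: "'a \<Rightarrow> 'a"
proof (intro exI conjI)
  \<comment> \<open>By Fermat, \<open>1 - (x - c) ^ (q - 1)\<close> is the indicator of
    \<open>c\<close>.\<close>
  let ?P = "\<Sum>c\<in>UNIV. smult (\<phi> c) (1 - [:- c, 1:] ^ (q - 1))"
  have "degree (smult (\<phi> c) (1 - [:- c, 1:] ^ (q - 1))) \<le> q - 1" for c
    by (rule order.trans[OF degree_smult_le], rule order.trans[OF degree_diff_le_max])
       (simp add: degree_linear_power)
  hence "degree ?P \<le> q - 1" by (intro degree_sum_le) auto
  thus "degree ?P < q" using q_gt_1 by linarith
  show "poly ?P = \<phi>"
  proof
    fix x
    have "poly ?P x = (\<Sum>c\<in>UNIV. \<phi> c * (1 - (x - c) ^ (q - 1)))"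
      by (simp add: poly_sum)
    also have "\<dots> = (\<Sum>c\<in>UNIV. if c = x then \<phi> c else 0)"
      using q_gt_1 by (intro sum.cong) (auto simp: power_q_minus_1[simplified] power_0_left)
    finally show "poly ?P x = \<phi> x" by simp
  qed
qed

lemma poly_eq_of_fun_eq:
  assumes "poly P = poly Q" "degree P < q" "degree (Q :: 'a poly) < q"
  shows "P = Q"
  using assms card by (intro poly_eqI_degree[of UNIV]) auto

section \<open>Subgroups of the multiplicative group and their power sums\<close>

definition power_subgroup :: "nat \<Rightarrow> 'a set" where
  "power_subgroup k = {\<omega> ^ (j * k) |j. True}"

lemma power_subgroup_eq_image:
  assumes "k * N = q - 1"
  shows "power_subgroup k = (\<lambda>j. \<omega> ^ (j * k)) ` {..<N}" "inj_on (\<lambda>j. \<omega> ^ (j * k)) {..<N}"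
proof -
  have kN: "k > 0" "N > 0" using assms q_gt_1 by (auto intro: gr0I)
  have "\<omega> ^ (j * k) = \<omega> ^ ((j mod N) * k)" for j
  proof -
    have "\<omega> ^ (j * k) = \<omega> ^ (N * (j div N) * k + (j mod N) * k)"
      by (metis add_mult_distrib mult_div_mod_eq)
    also have "\<dots> = \<omega> ^ (N * (j div N) * k) * \<omega> ^ ((j mod N) * k)" by (rule power_add)
    also have "\<omega> ^ (N * (j div N) * k) = 1"
      unfolding prim_power_eq_1_iff assms[symmetric] by (simp add: ac_simps)
    finally show ?thesis by simp
  qed
  thus "power_subgroup k = (\<lambda>j. \<omega> ^ (j * k)) ` {..<N}"
    unfolding power_subgroup_def using kN by auto (metis imageI lessThan_iff mod_less_divisor)
  show "inj_on (\<lambda>j. \<omega> ^ (j * k)) {..<N}"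
  proof (rule linorder_inj_onI')
    fix i j assume ij: "i \<in> {..<N}" "j \<in> {..<N}" "i < j"
    have "\<not> q - 1 dvd (j - i) * k"
      using ij kN by (subst assms[symmetric]) (auto simp: mult.commute dest!: dvd_imp_le)
    hence "\<omega> ^ ((j - i) * k) \<noteq> 1" by (simp add: prim_power_eq_1_iff)
    moreover have "\<omega> ^ (j * k) = \<omega> ^ (i * k) * \<omega> ^ ((j - i) * k)"
      using ij by (simp flip: power_add add_mult_distrib)
    ultimately show "\<omega> ^ (i * k) \<noteq> \<omega> ^ (j * k)" using prim_nonzero by auto
  qed
qed

text \<open>This is a geometric sum with ratio \<open>x = \<omega> ^ (k * i)\<close>, where
  \<open>x ^ N = 1\<close>. It vanishes unless \<open>x = 1\<close>, which means
  \<open>N dvd i\<close>.\<close>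

lemma power_sum_power_subgroup:
  assumes "k * N = q - 1"
  shows "(\<Sum>s\<in>power_subgroup k. s ^ i) = (if N dvd i then of_nat N else 0)"
proof -
  define x where "x = \<omega> ^ (k * i)"
  have kN: "k > 0" "N > 0" using assms q_gt_1 by (auto intro: gr0I)
  have "(\<Sum>s\<in>power_subgroup k. s ^ i) = (\<Sum>j<N. x ^ j)"
    unfolding power_subgroup_eq_image(1)[OF assms] sum.reindex[OF power_subgroup_eq_image(2)[OF assms]]
    by (simp add: x_def ac_simps flip: power_mult)
  moreover have "x = 1 \<longleftrightarrow> N dvd i"
    using kN unfolding x_def prim_power_eq_1_iff assms[symmetric] by simp
  moreover have "x ^ N = 1"
    unfolding x_def power_mult[symmetric] prim_power_eq_1_iff assms[symmetric] by simp
  ultimately show ?thesis by (auto simp: geometric_sum)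
qed

lemma divisor_nonzero: "N dvd q - 1 \<Longrightarrow> of_nat N \<noteq> (0 :: 'a)"
proof
  assume "N dvd q - 1" "of_nat N = (0 :: 'a)"
  hence "p dvd q - 1" by (auto simp: of_nat_eq_0_iff intro: dvd_trans)
  moreover have "p dvd q" using R_pos by simp
  ultimately have "p dvd 1" using q_gt_1 by (meson dvd_diffD1 order_less_imp_le)
  thus False using prime by simp
qed

lemma minus_1_eq: "odd p \<Longrightarrow> \<omega> ^ ((q - 1) div 2) = - 1"
proof -
  assume "odd p"
  hence e: "2 * ((q - 1) div 2) = q - 1" by simp
  have "(\<omega> ^ ((q - 1) div 2)) ^ 2 = 1"
    by (metis e dvd_refl mult.commute power_mult prim_power_eq_1_iff)
  moreover have "\<omega> ^ ((q - 1) div 2) \<noteq> 1"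
    using e q_gt_1 by (auto simp: prim_power_eq_1_iff dest!: dvd_imp_le)
  ultimately show ?thesis by (simp add: power2_eq_1_iff)
qed

lemma uminus_power_subgroup:
  assumes "odd p" "k * N = q - 1" "even N" "x \<in> power_subgroup k"
  shows "- x \<in> power_subgroup k"
proof -
  obtain j where "x = \<omega> ^ (j * k)" using assms by (auto simp: power_subgroup_def)
  hence "- x = \<omega> ^ ((q - 1) div 2) * \<omega> ^ (j * k)" using minus_1_eq assms by simp
  also have "(q - 1) div 2 = (N div 2) * k" using assms(2,3) by (metis dvd_div_mult mult.commute)
  finally have "- x = \<omega> ^ ((N div 2 + j) * k)" by (simp add: power_add add_mult_distrib)
  thus ?thesis by (auto simp: power_subgroup_def)
qed

lemma prim_power_in_power_subgroup_iff:
  assumes "k dvd q - 1"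
  shows "\<omega> ^ a \<in> power_subgroup k \<longleftrightarrow> k dvd a"
proof
  assume "k dvd a"
  thus "\<omega> ^ a \<in> power_subgroup k" by (auto simp: power_subgroup_def mult.commute elim!: dvdE)
next
  assume "\<omega> ^ a \<in> power_subgroup k"
  then obtain j where j: "\<omega> ^ a = \<omega> ^ (j * k)" by (auto simp: power_subgroup_def)
  have cancel: "k dvd n - m" if "m \<le> n" "\<omega> ^ m = \<omega> ^ n" for m n
  proof -
    have "\<omega> ^ m * \<omega> ^ (n - m) = \<omega> ^ m" using that by (metis le_add_diff_inverse power_add)
    hence "\<omega> ^ (n - m) = 1" using prim_nonzero by simp
    thus ?thesis using assms dvd_trans by (simp only: prim_power_eq_1_iff)
  qed
  show "k dvd a"
  proof (cases "a \<le> j * k")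
    case True
    then show ?thesis using cancel[OF True j] by (metis dvd_diffD1 dvd_triv_right)
  next
    case False
    then show ?thesis using cancel[of "j * k" a] j by (metis dvd_diffD dvd_triv_right nat_le_linear)
  qed
qed

end

subsection \<open>Digits in base \<open>p\<close>\<close>

lemma mod_div_add_mult:
  assumes "x < (p :: nat)"
  shows "(x + p * y) mod p = x" "(x + p * y) div p = y"
  using assms by simp_all

text \<open>The number with \<open>n\<close> digits in base \<open>b\<close>, all equal to 1. For
  \<open>u < b\<close>, all digits of \<open>u * repunit b n\<close> equal \<open>u\<close>.\<close>

primrec repunit :: "nat \<Rightarrow> nat \<Rightarrow> nat" where
  "repunit b 0 = 0"
| "repunit b (Suc n) = 1 + b * repunit b n"

lemma repunit_eq: "b > 0 \<Longrightarrow> (b - 1) * repunit b n = b ^ n - 1"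
proof -
  assume "b > 0"
  then obtain c where "b = Suc c" by (cases b) auto
  moreover have "c * repunit (Suc c) n + 1 = Suc c ^ n"
  proof (induction n)
    case (Suc n)
    have "c * repunit (Suc c) (Suc n) + 1 = Suc c * (c * repunit (Suc c) n + 1)"
      by (simp add: algebra_simps)
    thus ?case by (simp only: Suc power_Suc)
  qed simp
  ultimately show ?thesis by (metis add_diff_cancel_right' diff_Suc_1)
qed

lemma repunit_double: "repunit b (2 * n) = (b + 1) * repunit (b\<^sup>2) n"
  by (induction n) (auto simp: algebra_simps power2_eq_square)

lemma choose_repunit_nonzero:
  assumes "prime p" "CHAR('a::idom) = p" "v \<le> u" "u < p"
  shows "(of_nat (u * repunit p n choose v * repunit p n) :: 'a) \<noteq> 0"
proof (induction n)
  case (Suc n)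
  have "(u * repunit p (Suc n)) mod p = u" "(u * repunit p (Suc n)) div p = u * repunit p n"
    "(v * repunit p (Suc n)) mod p = v" "(v * repunit p (Suc n)) div p = v * repunit p n"
    using assms(3,4) by (simp_all add: distrib_left mult.left_commute[of _ p])
  thus ?case
    using Suc of_nat_choose_nonzero[OF assms(1,2), of v u] assms(3,4)
    by (subst lucas_step[OF assms(1,2)]) auto
qed simp

text \<open>The base case \<open>n = 0\<close> makes \<open>k\<close> a bound on the number of
  digits as well.\<close>

primrec digits_le :: "nat \<Rightarrow> nat \<Rightarrow> nat \<Rightarrow> nat \<Rightarrow> bool" where
  "digits_le p c 0 n \<longleftrightarrow> n = 0"
| "digits_le p c (Suc k) n \<longleftrightarrow> n mod p \<le> c \<and> digits_le p c k (n div p)"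

lemma digits_le_0: "digits_le p c k 0"
  by (induction k) auto

lemma digits_le_bound: "digits_le p c k n \<Longrightarrow> n \<le> c * repunit p k"
proof (induction k arbitrary: n)
  case (Suc k)
  have "n = n mod p + p * (n div p)" by simp
  also have "\<dots> \<le> c + p * (c * repunit p k)" using Suc by (intro add_mono mult_left_mono) auto
  finally show ?case by (simp add: algebra_simps)
qed simp

text \<open>Lucas forces each digit of \<open>a\<close> to be at least \<open>c\<close>; subtracting
  \<open>c\<close> without borrowing leaves at most \<open>p - 1 - c\<close>.\<close>

lemma digits_le_choose_repunit:
  assumes "prime p" "CHAR('a::idom) = p" "c < p"
  shows "(of_nat (a choose c * repunit p k) :: 'a) \<noteq> 0 \<Longrightarrow> a < p ^ k
    \<Longrightarrow> digits_le p (p - 1 - c) k (a - c * repunit p k)"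
proof (induction k arbitrary: a)
  case (Suc k)
  have *: "(c * repunit p (Suc k)) mod p = c" "(c * repunit p (Suc k)) div p = c * repunit p k"
    using assms(3) by (simp_all add: distrib_left mult.left_commute[of _ p])
  note D = choose_nonzeroD[OF assms(1,2) Suc.prems(1), unfolded *]
  have "a div p < p ^ k" using Suc.prems(2) by (simp add: less_mult_imp_div_less mult.commute)
  hence "digits_le p (p - 1 - c) k (a div p - c * repunit p k)" using Suc.IH D(2) by blast
  moreover have "a mod p \<le> p - 1" using mod_less_divisor[of p a] assms(3) by linarith
  ultimately show ?case using D(3,4) by (simp del: repunit.simps)
qed simp

text \<open>A multiplication \<open>m * L\<close> all of whose partial multiples have small digits produces no carry.\<close>

lemma digits_le_multiples:
  assumes "2 * c < p" "\<And>m. m \<le> M \<Longrightarrow> digits_le p c (Suc k) (m * L)" "m \<le> M"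
  shows "m * (L mod p) \<le> c \<and> (m * L) mod p = m * (L mod p) \<and> (m * L) div p = m * (L div p)"
  using assms(3)
proof (induction m)
  case (Suc m)
  have IH: "m * (L mod p) \<le> c" "(m * L) mod p = m * (L mod p)" "(m * L) div p = m * (L div p)"
    using Suc by auto
  have "L mod p \<le> c" using assms(2)[of 1] Suc.prems by simp
  hence lt: "m * (L mod p) + L mod p < p" using IH assms(1) by linarith
  have "Suc m * L = (m * L) + L" by simp
  hence 1: "(Suc m * L) mod p = m * (L mod p) + L mod p"
    by (metis IH(2) lt mod_add_eq mod_less)
  have 2: "(Suc m * L) div p = m * (L div p) + L div p"
    using lt by (simp add: div_add1_eq[of L] IH add.commute)
  show ?case using 1 2 assms(2)[OF Suc.prems] by (simp add: algebra_simps)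
qed simp

text \<open>Without carries, \<open>M * (L mod p)\<close> is at most \<open>c < M\<close>, so the
  lowest digit of \<open>L\<close> is 0; the hypothesis then passes to
  \<open>L div p\<close>.\<close>

lemma digits_le_multiples_eq_0:
  assumes "2 * c < p" "c < M"
  shows "(\<And>m. m \<le> M \<Longrightarrow> digits_le p c k (m * L)) \<Longrightarrow> L = 0"
proof (induction k arbitrary: L)
  case 0
  then show ?case using 0[of 1] assms by simp
next
  case (Suc k)
  have *: "m * (L mod p) \<le> c \<and> (m * L) mod p = m * (L mod p) \<and> (m * L) div p = m * (L div p)"
    if "m \<le> M" for m
    using assms(1) by (rule digits_le_multiples) (erule Suc.prems, fact that)
  have "M * (L mod p) < M * 1" using *[OF order_refl, THEN conjunct1] assms(2) by linarith
  hence "L mod p = 0" unfolding mult_less_cancel1 by linarith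
  moreover have "digits_le p c k (m * (L div p))" if "m \<le> M" for m
    using *[OF that, THEN conjunct2, THEN conjunct2] Suc.prems[OF that]
    by (metis digits_le.simps(2))
  hence "L div p = 0" by (rule Suc.IH)
  ultimately show ?case by (metis div_mult_mod_eq mult_0 add_0)
qed

text \<open>With multiples only up to \<open>c\<close>, each digit \<open>d\<close> of
  \<open>L\<close> satisfies \<open>c * d <= c\<close>, so it need not vanish but is at most
  1.\<close>

lemma digits_le_multiples_2:
  assumes "2 * c < p" "c > 0" "\<And>m. m \<le> c \<Longrightarrow> digits_le p c 2 (m * L)"
  shows "L mod p \<le> 1 \<and> L div p \<le> 1"
proof -
  note * = digits_le_multiples[OF assms(1) assms(3)[unfolded numeral_2_eq_2] order_refl]
  have "c * (L mod p) \<le> c * 1" using * by simp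
  moreover have "digits_le p c 1 (c * (L div p))"
    using * assms(3)[OF order_refl] by (metis One_nat_def digits_le.simps(2) numeral_2_eq_2)
  hence "c * (L div p) \<le> c * 1" using digits_le_bound by fastforce
  ultimately show ?thesis using assms(2) unfolding mult_le_cancel1 by blast
qed

subsection \<open>Digit patterns of the two connection sets\<close>

locale twisted_paley = primitive_field p R \<omega>
  for p R :: nat and \<omega> :: "'a::{field,finite}" +
  fixes h :: nat
  assumes p_mod_4: "p mod 4 = 3" and even_R: "even R"
    and h_pos: "h > 0" and odd_h: "odd h" and h_dvd: "2 * h dvd p - 1"
begin

text \<open>The common valency of the two graphs is \<open>2 * D\<close>, and its
  base-\<open>p\<close> digits all equal \<open>e\<close>.\<close>

definition e :: nat where "e = (p - 1) div (2 * h)"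
definition D :: nat where "D = (q - 1) div (4 * h)"

definition S :: "'a set" where "S = power_subgroup (2 * h)"
definition S' :: "'a set" where
  "S' = power_subgroup (4 * h) \<union> (\<lambda>s. \<omega> ^ (3 * h) * s) ` power_subgroup (4 * h)"

lemma GPaley_eq: "GPaley \<omega> (2 * h) = Cay S"
  by (simp add: GPaley_def S_def power_subgroup_def)

lemma TGPaley_eq: "TGPaley \<omega> h = Cay S'"
  by (simp add: TGPaley_def S'_def power_subgroup_def Let_def mult.commute)

lemma p_eq: "p = 2 * h * e + 1"
proof -
  have "p - 1 = 2 * h * e" using h_dvd by (simp add: e_def)
  thus ?thesis using p_gt_1 by linarith
qed

lemma odd_p: "odd p" using p_eq by (metis even_add even_mult_iff even_numeral odd_one)

lemma p_plus_1: "p + 1 = 2 * (2 * ((p + 1) div 4))" using p_mod_4 by presburger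

lemma odd_e: "odd e"
proof
  assume "even e"
  then obtain x where "e = 2 * x" by blast
  hence "p = 4 * (h * x) + 1" using p_eq by simp
  hence "p mod 4 = 1" by simp
  thus False using p_mod_4 by simp
qed

text \<open>Start from \<open>q - 1 = (p - 1) * repunit p R\<close>. Pairing digits splits off
  \<open>p + 1\<close>, a multiple of 4; writing the rest as \<open>1 + p\<^sup>2 * r\<close>
  isolates the two lowest digits.\<close>

lemma D_structure:
  obtains r where "D = e * ((p + 1) div 2) * (1 + p\<^sup>2 * r)" "2 * D = e * repunit p R" "4 * h * D = q - 1"
    "even D" "repunit (p\<^sup>2) (R div 2) = 1 + p\<^sup>2 * r"
proof -
  define n where "n = R div 2"
  have n: "R = 2 * n" "n > 0" using even_R R_pos by (auto simp: n_def)
  define r where "r = repunit (p\<^sup>2) (n - 1)"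
  have r: "repunit (p\<^sup>2) n = 1 + p\<^sup>2 * r" using n(2) unfolding r_def by (cases n) auto
  have rep: "repunit p R = (p + 1) * (1 + p\<^sup>2 * r)" by (simp only: n(1) repunit_double r)
  have "q - 1 = (p - 1) * repunit p R" using repunit_eq[of p R] p_gt_1 by simp
  hence q1: "q - 1 = 2 * h * e * repunit p R" using p_eq by (metis add_diff_cancel_right')
  have w: "p + 1 = 2 * ((p + 1) div 2)" using p_plus_1 by presburger
  have er: "e * repunit p R = 2 * (e * ((p + 1) div 2) * (1 + p\<^sup>2 * r))"
    unfolding rep by (subst (1) w) (simp only: ac_simps)
  have q2: "q - 1 = 4 * h * (e * ((p + 1) div 2) * (1 + p\<^sup>2 * r))"
  proof -
    have "q - 1 = 2 * h * (e * repunit p R)" using q1 by (simp only: mult.assoc)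
    also have "\<dots> = 4 * h * (e * ((p + 1) div 2) * (1 + p\<^sup>2 * r))"
      unfolding er by simp
    finally show ?thesis .
  qed
  hence D: "D = e * ((p + 1) div 2) * (1 + p\<^sup>2 * r)" unfolding D_def using h_pos by simp
  moreover have "2 * D = e * repunit p R" using D er by simp
  moreover have "4 * h * D = q - 1" using q2 D by simp
  moreover have "even D" 
  proof -
    have "(p + 1) div 2 = 2 * ((p + 1) div 4)" using p_plus_1 by presburger
    thus ?thesis unfolding D by simp
  qed
  ultimately show ?thesis using that[of r] r by (simp add: n_def)
qed

lemma four_h_D: "4 * h * D = q - 1" and two_D: "2 * D = e * repunit p R" and even_D: "even D"
  using D_structure by metis+

lemma D_pos: "D > 0" using four_h_D q_gt_1 by (cases D) auto

lemma prim_2hD: "\<omega> ^ (2 * h * D) = - 1"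
proof -
  have "(q - 1) div 2 = 2 * h * D" using four_h_D by simp
  thus ?thesis using minus_1_eq[OF odd_p] by simp
qed

lemma uminus_S: "x \<in> S \<Longrightarrow> - x \<in> S"
  unfolding S_def using four_h_D by (intro uminus_power_subgroup[of "2 * h" "2 * D"] odd_p) auto

lemma uminus_S': "x \<in> S' \<Longrightarrow> - x \<in> S'"
  unfolding S'_def using uminus_power_subgroup[of "4 * h" D] odd_p four_h_D even_D
  by auto (metis imageI mult_minus_right)

lemma ugraph_iso_iff:
  "ugraph_iso (GPaley \<omega> (2 * h)) (TGPaley \<omega> h) \<longleftrightarrow>
    (\<exists>f. bij f \<and> (\<forall>u v. v - u \<in> S \<longleftrightarrow> f v - f u \<in> S'))"
  unfolding GPaley_eq TGPaley_eq by (rule ugraph_iso_Cay_iff) (auto intro: uminus_S uminus_S')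

lemma power_sum_S: "(\<Sum>s\<in>S. s ^ i) = (if 2 * D dvd i then of_nat (2 * D) else 0)"
  unfolding S_def using four_h_D by (intro power_sum_power_subgroup) simp

text \<open>\<open>S'\<close> consists of two cosets of the \<open>4 * h\<close>-th powers, disjoint
  because \<open>4 * h\<close> does not divide \<open>3 * h\<close>. Passing to the second coset
  scales the power sum by \<open>\<omega> ^ (3 * h * i)\<close>.\<close>

lemma power_sum_S': "(\<Sum>s\<in>S'. s ^ i) = (if D dvd i then of_nat D * (1 + \<omega> ^ (3 * h * i)) else 0)"
proof -
  have "\<omega> ^ (3 * h) * s \<notin> power_subgroup (4 * h)" if s: "s \<in> power_subgroup (4 * h)" for s
  proof -
    obtain j where "s = \<omega> ^ (j * (4 * h))" using s by (auto simp: power_subgroup_def)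
    hence *: "\<omega> ^ (3 * h) * s = \<omega> ^ (3 * h + j * (4 * h))" by (simp add: power_add)
    have "4 * h dvd q - 1" using four_h_D by (metis dvd_triv_left)
    hence "\<omega> ^ (3 * h + j * (4 * h)) \<in> power_subgroup (4 * h) \<longleftrightarrow> 4 * h dvd 3 * h + j * (4 * h)"
      by (rule prim_power_in_power_subgroup_iff)
    also have "\<dots> \<longleftrightarrow> 4 * h dvd 3 * h" by (simp add: dvd_add_left_iff)
    also have "\<not> \<dots>" using h_pos by (auto dest!: dvd_imp_le)
    finally show ?thesis using * by simp
  qed
  hence "(\<Sum>s\<in>S'. s ^ i) = (\<Sum>s\<in>power_subgroup (4 * h). s ^ i)
      + (\<Sum>s\<in>(\<lambda>s. \<omega> ^ (3 * h) * s) ` power_subgroup (4 * h). s ^ i)"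
    unfolding S'_def by (intro sum.union_disjoint) auto
  also have "(\<Sum>s\<in>(\<lambda>s. \<omega> ^ (3 * h) * s) ` power_subgroup (4 * h). s ^ i)
      = \<omega> ^ (3 * h * i) * (\<Sum>s\<in>power_subgroup (4 * h). s ^ i)"
    using prim_nonzero
    by (subst sum.reindex) (auto simp: inj_on_def power_mult_distrib sum_distrib_left power_mult)
  finally show ?thesis
    using power_sum_power_subgroup[of "4 * h" D i] four_h_D by (simp add: algebra_simps)
qed

text \<open>Since \<open>\<omega> ^ (2 * h * D) = - 1\<close>, the two cosets contribute opposite
  sums. Transitions by odd multiples of \<open>2 * D\<close>, which \<open>S\<close> permits, are
  thus closed to \<open>S'\<close>.\<close>

lemma power_sum_S'_eq_0:
  assumes "m mod 4 = 2"
  shows "(\<Sum>s\<in>S'. s ^ (m * D)) = 0"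
proof -
  obtain n where n: "m = 4 * n + 2" using assms by (metis mult_div_mod_eq)
  have "3 * h * (m * D) = (4 * h * D) * (3 * n) + (2 * h * D) * 3" by (simp add: n algebra_simps)
  hence "\<omega> ^ (3 * h * (m * D)) = (\<omega> ^ (4 * h * D)) ^ (3 * n) * (\<omega> ^ (2 * h * D)) ^ 3"
    by (simp only: power_add power_mult)
  also have "\<omega> ^ (4 * h * D) = 1" by (simp add: four_h_D prim_power_eq_1_iff)
  finally show ?thesis by (simp add: power_sum_S' prim_2hD)
qed


subsection \<open>The case \<open>h \<ge> 3\<close>\<close>

text \<open>The least positive step is \<open>2 * D\<close>, so each application lowers the leading
  exponent by that amount. All digits of these exponents are equal, so Lucas keeps the leading
  coefficient nonzero, down to a constant after \<open>2 * h\<close> steps.\<close>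

lemma shift_sum_S_funpow_coeff:
  assumes "n \<le> 2 * h"
  defines "P \<equiv> (poly_shift_sum S ^^ n) (monom 1 (q - 1))"
  shows "degree P \<le> (2 * h - n) * (2 * D) \<and> coeff P ((2 * h - n) * (2 * D)) \<noteq> 0"
  using assms(1) unfolding P_def
proof (induction n)
  case 0
  then show ?case using four_h_D by (simp add: mult.left_commute mult.commute degree_monom_le)
next
  case (Suc n)
  let ?P = "(poly_shift_sum S ^^ n) (monom 1 (q - 1))"
  define a b where "a = (2 * h - n) * (2 * D)" and "b = (2 * h - Suc n) * (2 * D)"
  have "2 * h - n = Suc (2 * h - Suc n)" using Suc.prems by simp
  hence ab: "a = b + 2 * D" by (simp add: a_def b_def)
  have IH: "degree ?P \<le> a" "coeff ?P a \<noteq> 0" using Suc by (auto simp: a_def)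
  have gap: "\<not> 2 * D dvd i" if "0 < i" "i < 2 * D" for i using that by (auto dest: dvd_imp_le)
  have deg: "coeff (poly_shift_sum S ?P) i = 0" if "i > b" for i
    unfolding coeff_poly_shift_sum[OF IH(1)] power_sum_S
    using that ab by (intro sum.neutral) (auto simp: gap)
  have "coeff (poly_shift_sum S ?P) b
      = (\<Sum>j\<in>{b<..a}. coeff ?P j * of_nat (j choose b) * (\<Sum>s\<in>S. s ^ (j - b)))"
    by (rule coeff_poly_shift_sum[OF IH(1)])
  also have "\<dots> = (\<Sum>j\<in>{a}. coeff ?P j * of_nat (j choose b) * (\<Sum>s\<in>S. s ^ (j - b)))"
    using ab D_pos gap by (intro sum.mono_neutral_right) (auto simp: power_sum_S)
  also have "\<dots> = coeff ?P a * of_nat (a choose b) * of_nat (2 * D)"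
    by (simp add: power_sum_S ab)
  also have "\<dots> \<noteq> 0"
  proof -
    have "2 * D dvd q - 1" 
    proof -
      have "q - 1 = (2 * h) * (2 * D)" unfolding four_h_D[symmetric] by simp
      thus ?thesis by (metis dvd_triv_right)
    qed
    hence 1: "of_nat (2 * D) \<noteq> (0 :: 'a)" by (rule divisor_nonzero)
    have "(2 * h - n) * e \<le> 2 * h * e" by (intro mult_right_mono) auto
    hence "(2 * h - n) * e < p" using p_eq by linarith
    moreover have "a = (2 * h - n) * e * repunit p R" "b = (2 * h - Suc n) * e * repunit p R"
      by (simp_all only: a_def b_def two_D mult.assoc)
    ultimately have "of_nat (a choose b) \<noteq> (0 :: 'a)"
      by (simp only:) (intro choose_repunit_nonzero prime char mult_right_mono, auto)
    with 1 IH(2) show ?thesis by simp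
  qed
  finally show ?case using deg by (auto simp: b_def[symmetric] intro: degree_le)
qed

text \<open>If 4 divides \<open>m\<close>, the lowest digit is a positive multiple of
  \<open>2 * e\<close>. The residue 2 is excluded by the vanishing power sum. For odd
  \<open>m\<close>, one of the two lowest digits reaches \<open>(p + 1) div 2\<close>.\<close>

lemma S'_step_digits:
  assumes "0 < m" "m * D < q" "(\<Sum>s\<in>S'. s ^ (m * D)) \<noteq> 0"
  shows "(m * D) mod p \<ge> 2 * e \<or> (m * D) mod p \<ge> (p + 1) div 2 \<or> (m * D) div p mod p \<ge> (p + 1) div 2"
proof -
  obtain r where r: "D = e * ((p + 1) div 2) * (1 + p\<^sup>2 * r)" using D_structure by blast
  define w where "w = (p + 1) div 2"
  have w: "p + 1 = 2 * w" unfolding w_def using p_plus_1 by presburger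
  have "m * D \<le> 4 * h * D" using assms(2) four_h_D by simp
  hence m: "m \<le> 4 * h" using D_pos by simp
  have "m mod 4 = 0 \<or> m mod 4 = 2 \<or> odd m" by presburger
  then consider "m mod 4 = 0" | "m mod 4 = 2" | "odd m" by metis
  thus ?thesis
  proof cases
    case 1
    then obtain n where n: "m = 4 * n" by auto
    have "1 \<le> n" "n \<le> h" using n m assms(1) by auto
    hence "2 * 1 * e \<le> 2 * n * e" "2 * n * e \<le> 2 * h * e" by (simp_all only: mult_le_mono)
    hence ne: "2 * e \<le> 2 * n * e" "2 * n * e < p" using p_eq by linarith+
    obtain R' where "R = Suc R'" using R_pos by (cases R) auto
    hence rep: "repunit p R = 1 + p * repunit p R'" by simp
    have "m * D = 2 * n * (2 * D)" by (simp add: n)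
    also have "\<dots> = 2 * n * e + p * (2 * n * e * repunit p R')"
      unfolding two_D rep by (simp add: algebra_simps)
    finally have "(m * D) mod p = 2 * n * e" using ne(2) by simp
    thus ?thesis using ne(1) by simp
  next
    case 2
    then show ?thesis using assms(3) power_sum_S'_eq_0 by simp
  next
    case 3
    hence "odd (m * e)" using odd_e by simp
    then obtain k where k: "m * e = 2 * k + 1" by (rule oddE)
    have "m \<noteq> 4 * h" using 3 by auto
    hence "m * e \<le> (4 * h - 1) * e" using m by (intro mult_right_mono) auto
    also have "\<dots> = 2 * (p - 1) - e" using p_eq by (simp add: algebra_simps diff_mult_distrib)
    finally have "m * e < 2 * (p - 1)" using odd_e p_gt_1 by (cases e) auto
    hence kp: "k + 1 < p" using k by linarith
    have "m * D = (m * e) * w * (1 + p\<^sup>2 * r)" by (simp only: r w_def ac_simps)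
    \<comment> \<open>As \<open>2 * w = p + 1\<close>, this odd multiple of \<open>w\<close> has
      \<open>k + w\<close> and \<open>k\<close> in its two lowest places before carrying.\<close>
    also have "(m * e) * w = k * (p + 1) + w" unfolding w k by (simp add: algebra_simps)
    finally have mD: "m * D = k + w + p * (k + p * ((k * (p + 1) + w) * r))"
      by (simp add: algebra_simps power2_eq_square)
    show ?thesis
    proof (cases "k + w < p")
      case True
      hence "(m * D) mod p = k + w" by (simp add: mD)
      thus ?thesis by (simp add: w_def)
    next
      case False
      \<comment> \<open>The carry raises the second digit to \<open>k + 1\<close>, and
        \<open>k + w >= p = 2 * w - 1\<close> makes it at least \<open>w\<close>.\<close>
      define y where "y = k + w - p"
      have y: "k + w = y + p" using False by (simp add: y_def)
      have "y < p" using y kp w by linarith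
      define x where "x = (k + 1) + p * ((k * (p + 1) + w) * r)"
      have "m * D = y + p * x"
        unfolding mD y x_def by (simp add: algebra_simps)
      hence "(m * D) div p = x" using \<open>y < p\<close> by simp
      moreover have "x mod p = k + 1" unfolding x_def mod_mult_self2 using kp by simp
      ultimately have "(m * D) div p mod p = k + 1" by simp
      moreover have "w \<le> k + 1" using False w by linarith
      ultimately show ?thesis by (simp add: w_def)
    qed
  qed
qed

text \<open>Every exponent transition of the twisted operator lowers this quantity, which is at most \<open>h + 2\<close>;
  hence \<open>2h\<close> transitions in a row are impossible once \<open>h \<ge> 3\<close>.\<close>

definition potential :: "nat \<Rightarrow> nat" where
  "potential a = (a mod p) div (2 * e) + (if a mod p \<ge> (p + 1) div 2 then 1 else 0)
     + (if a div p mod p \<ge> (p + 1) div 2 then 1 else 0)"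

lemma potential_le: "potential a \<le> h + 2"
proof -
  have "a mod p \<le> h * (2 * e)" using mod_less_divisor[of p a] p_gt_1 p_eq by (simp only: ac_simps) linarith
  hence "(a mod p) div (2 * e) \<le> h" by (metis div_le_mono nonzero_mult_div_cancel_right div_by_0 le0 zero_le)
  thus ?thesis by (simp add: potential_def)
qed

lemma potential_less:
  assumes "b < a" "a < q" "of_nat (a choose b) \<noteq> (0 :: 'a)" "(\<Sum>s\<in>S'. s ^ (a - b)) \<noteq> 0"
  shows "potential b < potential a"
proof -
  have "D dvd a - b" using assms(4) power_sum_S'[of "a - b"] by (auto split: if_splits)
  then obtain m where m: "a - b = m * D" by (metis dvdE mult.commute)
  \<comment> \<open>By symmetry of the binomial, domination applies to the step \<open>m * D\<close>
    itself: its digits are subtracted from those of \<open>a\<close> without borrowing.\<close>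
  have ch: "of_nat (a choose (m * D)) \<noteq> (0 :: 'a)"
    using assms(1,3) m by (metis binomial_symmetric less_imp_le)
  have b: "b = a - m * D" using m assms(1) by linarith
  have "0 < m" "m * D < q" using m assms(1,2) by (auto intro: gr0I)
  note step = S'_step_digits[OF this] 
  note d0 = choose_nonzeroD[OF prime char ch, folded b]
  note d1 = choose_nonzeroD[OF prime char d0(2), folded d0(4)]
  define x y c d where "x = a mod p" and "y = a div p mod p"
    and "c = (m * D) mod p" and "d = (m * D) div p mod p"
  have c: "c \<le> x" "b mod p = x - c" using d0 by (simp_all add: x_def c_def)
  have d: "d \<le> y" "b div p mod p = y - d" using d1 by (simp_all add: y_def d_def)
  have xy: "x < p" "y < p" using p_gt_1 by (simp_all add: x_def y_def)
  have s: "c \<ge> 2 * e \<or> c \<ge> (p + 1) div 2 \<or> d \<ge> (p + 1) div 2"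
    using step assms(4) m by (simp add: c_def d_def)
  have e0: "e > 0" using odd_e by (cases e) auto
  have mono: "(x - c) div (2 * e) \<le> x div (2 * e)" by (simp add: div_le_mono)
  have drop: "(x - c) div (2 * e) < x div (2 * e)" if "2 * e \<le> c"
  proof -
    have "(x - c) div (2 * e) \<le> (x - 2 * e) div (2 * e)" using that by (intro div_le_mono) simp
    also have "\<dots> < x div (2 * e)" using that c e0 by (subst (2) le_div_geq) auto
    finally show ?thesis .
  qed
  define w :: nat where "w = (p + 1) div 2"
  have w: "p < 2 * w" unfolding w_def using odd_p by presburger
  define ind :: "nat \<Rightarrow> nat" where "ind z = (if w \<le> z then 1 else 0)" for z
  have mono': "ind (x - c) \<le> ind x" "ind (y - d) \<le> ind y" by (auto simp: ind_def)
  have drop_x: "ind (x - c) < ind x" if "w \<le> c"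
  proof -
    have "x - c < w" "w \<le> x" using that c(1) xy(1) w by linarith+
    thus ?thesis by (simp add: ind_def)
  qed
  have drop_y: "ind (y - d) < ind y" if "w \<le> d"
  proof -
    have "y - d < w" "w \<le> y" using that d(1) xy(2) w by linarith+
    thus ?thesis by (simp add: ind_def)
  qed
  have "potential b = (x - c) div (2 * e) + ind (x - c) + ind (y - d)"
    by (simp only: potential_def c d ind_def w_def)
  moreover have "potential a = x div (2 * e) + ind x + ind y"
    by (simp only: potential_def x_def y_def ind_def w_def)
  moreover have "(x - c) div (2 * e) < x div (2 * e) \<or> ind (x - c) < ind x \<or> ind (y - d) < ind y"
    using s drop drop_x drop_y unfolding w_def by blast
  ultimately show ?thesis using mono mono' by linarith
qed

lemma shift_sum_S'_funpow_coeff: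
  assumes "degree P < q"
  shows "degree ((poly_shift_sum S' ^^ n) P) < q \<and>
    (\<forall>b. coeff ((poly_shift_sum S' ^^ n) P) b \<noteq> 0 \<longrightarrow> potential b + n \<le> h + 2)"
proof (induction n)
  case 0
  then show ?case using assms potential_le by simp
next
  case (Suc n)
  let ?P = "(poly_shift_sum S' ^^ n) P"
  have "potential b + Suc n \<le> h + 2" if nz: "coeff (poly_shift_sum S' ?P) b \<noteq> 0" for b
  proof -
    obtain a where a: "a \<in> {b<..degree ?P}"
      "coeff ?P a * of_nat (a choose b) * (\<Sum>s\<in>S'. s ^ (a - b)) \<noteq> 0"
      using nz unfolding coeff_poly_shift_sum[OF order_refl]
      by (rule sum.not_neutral_contains_not_neutral)
    hence "potential b < potential a" using Suc by (intro potential_less) auto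
    moreover have "potential a + n \<le> h + 2" using Suc a by auto
    ultimately show ?thesis by simp
  qed
  thus ?case using Suc degree_poly_shift_sum_le[of S' ?P] by (simp add: order_le_less_trans)
qed

lemma not_iso_of_h_ge_3:
  assumes "h \<ge> 3" "bij f" "\<And>u v. v - u \<in> S \<longleftrightarrow> f v - f u \<in> S'"
  shows False
proof -
  \<comment> \<open>Transport \<open>x ^ (q - 1)\<close> to the twisted graph, so that composing
    with \<open>f\<close> recovers it.\<close>
  obtain Q where Q: "degree Q < q" "poly Q = poly (monom 1 (q - 1)) \<circ> inv f"
    using interpolation by blast
  \<comment> \<open>Here \<open>2 * h > h + 2\<close>, so the potential leaves no exponent after
    \<open>2 * h\<close> steps.\<close>
  have "(poly_shift_sum S' ^^ (2 * h)) Q = 0"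
    using shift_sum_S'_funpow_coeff[OF Q(1), of "2 * h"] assms(1) by (intro poly_eqI) force
  hence "(shift_sum S' ^^ (2 * h)) (poly Q) = (\<lambda>_. 0)"
    by (simp flip: poly_funpow_shift_sum add: fun_eq_iff)
  hence "(\<lambda>_. 0) \<circ> f = (shift_sum S ^^ (2 * h)) (poly Q \<circ> f)"
    using shift_sum_funpow_iso[OF assms(2,3), of "2 * h" "poly Q"] by simp
  also have "poly Q \<circ> f = poly (monom 1 (q - 1))"
    using assms(2) by (simp add: Q(2) comp_assoc bij_is_inj)
  finally have 0: "poly ((poly_shift_sum S ^^ (2 * h)) (monom 1 (q - 1))) = (\<lambda>_. 0)"
    by (simp add: poly_funpow_shift_sum comp_def)
  have "coeff ((poly_shift_sum S ^^ (2 * h)) (monom 1 (q - 1))) 0 \<noteq> 0"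
    using shift_sum_S_funpow_coeff[of "2 * h"] by simp
  thus False using 0 by (metis poly_0_coeff_0)
qed

subsection \<open>The case \<open>h = 1\<close>\<close>

definition small :: "'a poly \<Rightarrow> bool" where
  "small P \<longleftrightarrow> (\<forall>b. coeff P b \<noteq> 0 \<longrightarrow> digits_le p e R b)"

lemma small_degree:
  assumes "small P"
  shows "degree P \<le> 2 * D"
proof (cases "P = 0")
  case False
  hence "digits_le p e R (degree P)" using assms by (simp add: small_def)
  thus ?thesis using digits_le_bound two_D by simp
qed simp

lemma small_smult: "small P \<Longrightarrow> small (smult c P)"
  by (simp add: small_def)

text \<open>Now \<open>q - 1 = 2 * (2 * D)\<close>, so the only steps are \<open>2 * D\<close> and
  \<open>q - 1\<close>. The first takes \<open>e\<close> from every digit and leaves at most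
  \<open>p - 1 - e = e\<close>; the second ends at exponent 0.\<close>

lemma small_shift_sum_S:
  assumes "h = 1" "degree P < q"
  shows "small (poly_shift_sum S P)"
  unfolding small_def
proof (intro allI impI)
  fix b
  assume "coeff (poly_shift_sum S P) b \<noteq> 0"
  then obtain a where a: "a \<in> {b<..degree P}"
      "coeff P a * of_nat (a choose b) * (\<Sum>s\<in>S. s ^ (a - b)) \<noteq> 0"
    unfolding coeff_poly_shift_sum[OF order_refl] by (rule sum.not_neutral_contains_not_neutral)
  hence "2 * D dvd a - b" using power_sum_S[of "a - b"] by (auto split: if_splits)
  then obtain k where k: "a - b = k * (2 * D)" by (metis dvdE mult.commute)
  have q: "q = 2 * (2 * D) + 1" using four_h_D assms(1) q_gt_1 by simp
  have "b < a" "a < q" using a assms(2) by auto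
  have "k * (2 * D) \<le> 2 * (2 * D)" using \<open>a < q\<close> k q by linarith
  hence "k \<le> 2" using D_pos by simp
  moreover have "k \<noteq> 0" using k \<open>b < a\<close> by (intro notI) simp
  ultimately consider "k = 1" | "k = 2" by linarith
  thus "digits_le p e R b"
  proof cases
    case 1
    hence b: "b = a - e * repunit p R" using k \<open>b < a\<close> two_D by simp
    have "of_nat (a choose (a - b)) \<noteq> (0 :: 'a)"
      using a \<open>b < a\<close> by (metis binomial_symmetric less_imp_le mult_zero_left mult_zero_right)
    moreover have "a - b = e * repunit p R" using k 1 two_D by simp
    moreover have "e < p" "p - 1 - e = e" using p_eq assms(1) by auto
    ultimately show ?thesis
      using digits_le_choose_repunit[OF prime char, of e a R] \<open>a < q\<close> b by simp
  next
    case 2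
    hence "a - b = 2 * (2 * D)" using k by simp
    hence "b = 0" using \<open>a < q\<close> \<open>b < a\<close> q by linarith
    then show ?thesis by (simp add: digits_le_0)
  qed
qed

text \<open>Only steps \<open>D\<close>, \<open>2 * D\<close> and \<open>3 * D\<close> are possible.
  The first dies by its binomial, the second by its power sum, and the third yields
  \<open>x ^ l\<close>.\<close>

lemma shift_sum_S'_monom:
  assumes "h = 1" "l < D" "of_nat (l + 3 * D choose 3 * D) \<noteq> (0 :: 'a)"
    "of_nat (l + 3 * D choose D) = (0 :: 'a)"
  shows "\<exists>c\<noteq>0. poly_shift_sum S' (monom 1 (l + 3 * D)) = monom c l"
proof (intro exI conjI)
  define a where "a = l + 3 * D"
  define c where "c = of_nat (a choose l) * (\<Sum>s\<in>S'. s ^ (3 * D))"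
  have sym: "(a choose l) = (l + 3 * D choose 3 * D)"
    unfolding a_def by (subst binomial_symmetric) simp_all
  \<comment> \<open>Since \<open>\<omega> ^ (9 * D) = \<omega> ^ D\<close>, the power sum of
    exponent \<open>3 * D\<close> is \<open>D * (1 + i)\<close>, nonzero because a square root of -1
    differs from -1.\<close>
  define i where "i = \<omega> ^ D"
  have i: "i ^ 2 = - 1" using prim_2hD assms(1) by (simp add: i_def mult.commute flip: power_mult)
  have "\<omega> ^ (4 * D) = 1" using four_h_D assms(1) by (simp add: prim_power_eq_1_iff)
  moreover have "\<omega> ^ (3 * h * (3 * D)) = (\<omega> ^ (4 * D)) ^ 2 * i"
    using assms(1) by (simp add: i_def flip: power_mult power_add)
  ultimately have "(\<Sum>s\<in>S'. s ^ (3 * D)) = of_nat D * (1 + i)" by (simp add: power_sum_S')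
  moreover have "1 + i \<noteq> 0"
  proof
    assume "1 + i = 0"
    hence "i = - 1" by (simp add: eq_neg_iff_add_eq_0 add.commute)
    hence "(1 :: 'a) = - 1" using i by simp
    hence "1 + 1 = (0 :: 'a)" by (metis add.right_inverse)
    hence "of_nat 2 = (0 :: 'a)" by simp
    hence "p dvd 2" by (simp only: of_nat_eq_0_iff)
    hence "p = 2" using p_gt_1 dvd_imp_le[of p 2] by simp
    thus False using odd_p by simp
  qed
  moreover have "of_nat D \<noteq> (0 :: 'a)"
    using four_h_D by (intro divisor_nonzero) (metis dvd_triv_right)
  ultimately show "c \<noteq> 0" using assms(3) by (simp add: c_def sym)
  have coeff: "coeff (poly_shift_sum S' (monom 1 a)) b
      = (if b < a then of_nat (a choose b) * (\<Sum>s\<in>S'. s ^ (a - b)) else 0)" for b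
  proof -
    have "coeff (poly_shift_sum S' (monom 1 a)) b = (\<Sum>j\<in>{b<..a}. if j = a
        then of_nat (a choose b) * (\<Sum>s\<in>S'. s ^ (a - b)) else 0)"
      unfolding coeff_poly_shift_sum[OF degree_monom_le] by (intro sum.cong) auto
    thus ?thesis by simp
  qed
  show "poly_shift_sum S' (monom 1 (l + 3 * D)) = monom c l"
  proof (rule poly_eqI, fold a_def)
    fix b
    show "coeff (poly_shift_sum S' (monom 1 a)) b = coeff (monom c l) b"
    proof (cases "b < a \<and> D dvd a - b")
      case True
      then obtain m where m: "a - b = m * D" by (metis dvdE mult.commute)
      have "m * D < 4 * D" using m assms(2) a_def by linarith
      hence "m < 4" by simp
      moreover have "m \<noteq> 0" using m True by (intro notI) simp
      ultimately consider "m = 1" | "m = 2" | "m = 3" by linarith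
      thus ?thesis
      proof cases
        case 1
        hence "b = a - D" "b \<noteq> l" using m True D_pos a_def by auto
        moreover have "(a choose b) = (a choose D)"
          using True m 1 by (subst binomial_symmetric) auto
        ultimately show ?thesis using assms(4) by (simp add: coeff flip: a_def)
      next
        case 2
        hence "b \<noteq> l" using m D_pos a_def by auto
        thus ?thesis using power_sum_S'_eq_0[of 2] m 2 by (simp add: coeff)
      next
        case 3
        hence "a - b = 3 * D" using m by simp
        hence "b = l" using True a_def by linarith
        thus ?thesis using True m 3 by (simp add: coeff c_def)
      qed
    next
      case False
      moreover have "b \<noteq> l" using False D_pos by (auto simp: a_def)
      ultimately show ?thesis by (auto simp: coeff power_sum_S')
    qed
  qed
qed

text \<open>Up to a scalar, \<open>x ^ l\<close> is in the image of the twisted operator, so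
  intertwining puts its composite with \<open>f\<close> in the image for \<open>S\<close>, where
  everything is small.\<close>

lemma iso_power_small:
  assumes "h = 1" "bij f" "\<And>u v. v - u \<in> S \<longleftrightarrow> f v - f u \<in> S'"
    "l < D" "of_nat (l + 3 * D choose 3 * D) \<noteq> (0 :: 'a)" "of_nat (l + 3 * D choose D) = (0 :: 'a)"
  shows "\<exists>G. small G \<and> (\<forall>x. f x ^ l = poly G x)"
proof -
  obtain c where c: "c \<noteq> 0" "poly_shift_sum S' (monom 1 (l + 3 * D)) = monom c l"
    using shift_sum_S'_monom assms by blast
  obtain P where P: "degree P < q" "poly P = poly (monom 1 (l + 3 * D)) \<circ> f"
    using interpolation by blast
  have "poly (monom c l) \<circ> f = shift_sum S (poly P)"
    unfolding P(2) shift_sum_iso[OF assms(2,3), symmetric] by (simp flip: c(2) add: poly_poly_shift_sum)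
  hence "c * f x ^ l = poly (poly_shift_sum S P) x" for x
    by (simp add: fun_eq_iff poly_poly_shift_sum poly_monom)
  hence "f x ^ l = poly (smult (inverse c) (poly_shift_sum S P)) x" for x
    using c(1) by (simp add: field_simps)
  thus ?thesis using small_smult small_shift_sum_S[OF assms(1) P(1)] by blast
qed

text \<open>Small polynomials have degree at most \<open>2 * D\<close>, and
  \<open>4 * D = q - 1\<close>, so the product undergoes no reduction modulo
  \<open>X ^ q - X\<close>.\<close>

lemma small_mult:
  assumes "h = 1" "small F" "small G" "small H" "\<And>x. poly F x * poly G x = poly H x"
  shows "F * G = H"
proof (rule poly_eq_of_fun_eq)
  show "poly (F * G) = poly H" using assms(5) by (auto simp: fun_eq_iff)
  have q: "4 * D < q" using four_h_D assms(1) q_gt_1 by simp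
  have "degree (F * G) \<le> degree F + degree G" by (rule degree_mult_le)
  thus "degree (F * G) < q" using q small_degree[OF assms(2)] small_degree[OF assms(3)] by linarith
  show "degree H < q" using q small_degree[OF assms(4)] by linarith
qed

text \<open>The hypothesis concerns only functions; multiplying by \<open>F\<close> one factor at a
  time, \<open>small_mult\<close> turns it into a statement about formal powers, whose degrees are
  known.\<close>

lemma small_power:
  assumes "h = 1" "small F"
    and "\<And>m. m \<le> M \<Longrightarrow> \<exists>G. small G \<and> (\<forall>x. poly F x ^ m = poly G x)" "m \<le> M"
  shows "small (F ^ m)"
  using assms(4)
proof (induction m)
  case 0
  then show ?case using digits_le_0 by (auto simp: small_def)
next
  case (Suc m)
  obtain G where G: "small G" "\<And>x. poly F x ^ Suc m = poly G x" using assms(3)[OF Suc.prems] by blast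
  have "F * F ^ m = G"
    using Suc G by (intro small_mult assms(1,2)) auto
  thus ?case using G(1) by simp
qed

lemma small_power_degree:
  assumes "small (F ^ m)" "F \<noteq> 0"
  shows "digits_le p e R (m * degree F)"
  using assms by (metis degree_power_eq leading_coeff_0_iff power_not_zero small_def)

text \<open>From the lowest digit on, \<open>D\<close> alternates \<open>3 * t + 2\<close>,
  \<open>t\<close>, while \<open>3 * D\<close> alternates \<open>t\<close>,
  \<open>3 * t + 2\<close>. This opposition makes the binomial for \<open>D\<close> vanish while
  that for \<open>3 * D\<close> survives.\<close>

lemma D_eq_of_h_1:
  assumes "h = 1" "t = p div 4"
  shows "e = 2 * t + 1" "p = 4 * t + 3"
    "D = (3 * t + 2 + p * t) * repunit (p\<^sup>2) (R div 2)"
    "3 * D = (t + p * (3 * t + 2)) * repunit (p\<^sup>2) (R div 2)"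
proof -
  show p: "p = 4 * t + 3" using p_mod_4 assms(2) by presburger
  show e: "e = 2 * t + 1" using p p_eq assms(1) by simp
  obtain r where r: "D = e * ((p + 1) div 2) * (1 + p\<^sup>2 * r)"
    "repunit (p\<^sup>2) (R div 2) = 1 + p\<^sup>2 * r" using D_structure by metis
  have "(p + 1) div 2 = 2 * t + 2" using p by presburger
  hence D: "D = (2 * t + 1) * (2 * t + 2) * repunit (p\<^sup>2) (R div 2)" using r e by simp
  have "(2 * t + 1) * (2 * t + 2) = 3 * t + 2 + p * t"
    "3 * ((2 * t + 1) * (2 * t + 2)) = t + p * (3 * t + 2)"
    by (simp_all add: p algebra_simps)
  thus "D = (3 * t + 2 + p * t) * repunit (p\<^sup>2) (R div 2)"
    "3 * D = (t + p * (3 * t + 2)) * repunit (p\<^sup>2) (R div 2)"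
    using D by (simp_all only: mult.assoc[symmetric])
qed

text \<open>Any \<open>j\<close> up to \<open>3 * t + 2\<close> can be added to the lowest digit of
  \<open>3 * D\<close> without carry, leaving the third digit to break domination of
  \<open>D\<close>. As \<open>3 * t + 2 > e\<close>, so many small powers force a constant
  \<open>f\<close>.\<close>

lemma not_iso_of_R_ge_4:
  assumes "h = 1" "R \<ge> 4" "bij f" "\<And>u v. v - u \<in> S \<longleftrightarrow> f v - f u \<in> S'"
  shows False
proof -
  define t where "t = p div 4"
  note t = D_eq_of_h_1[OF assms(1) t_def]
  define n where "n = R div 2 - 2"
  have "R div 2 = Suc (Suc n)" using assms(2) unfolding n_def by linarith
  then obtain r where r: "repunit (p\<^sup>2) (R div 2) = 1 + p\<^sup>2 * (1 + p\<^sup>2 * r)"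
    using that[of "repunit (p\<^sup>2) n"] by simp
  have small_pow: "\<exists>G. small G \<and> (\<forall>x. f x ^ j = poly G x)" if j: "j \<le> 3 * t + 2" for j
  proof (rule iso_power_small[OF assms(1,3,4)])
    define a where "a = j + 3 * D"
    \<comment> \<open>These are the quotients of \<open>D\<close>, respectively
      \<open>3 * D\<close>, by \<open>p\<close>, its square and its cube.\<close>
    define X3 X2 X1 where "X3 = t + p * ((3 * t + 2 + p * t) * r)"
      and "X2 = 3 * t + 2 + p * X3" and "X1 = t + p * X2"
    define Y3 Y2 Y1 where "Y3 = 3 * t + 2 + p * ((t + p * (3 * t + 2)) * r)"
      and "Y2 = t + p * Y3" and "Y1 = 3 * t + 2 + p * Y2"
    have D: "D = 3 * t + 2 + p * X1"
      unfolding t(3) r X1_def X2_def X3_def by (simp add: algebra_simps power2_eq_square)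
    have D3: "3 * D = t + p * Y1"
      unfolding t(4) r Y1_def Y2_def Y3_def by (simp add: algebra_simps power2_eq_square)
    have lt: "t + j < p" "3 * t + 2 < p" "t < p" using j t(2) by auto
    have "0 < p * X1" using p_gt_1 by (simp add: X1_def X2_def)
    thus "j < D" unfolding D using j by linarith
    have a: "a = (t + j) + p * Y1" unfolding a_def D3 by simp
    have a_dig: "a mod p = t + j" "a div p = Y1" and D3_dig: "3 * D mod p = t" "3 * D div p = Y1"
      unfolding a D3 using lt by (simp_all only: mod_div_add_mult)
    hence "of_nat (a choose 3 * D) = (of_nat (t + j choose t) :: 'a)"
      by (simp add: lucas_step[OF prime char, of a])
    thus "of_nat (j + 3 * D choose 3 * D) \<noteq> (0 :: 'a)"
      using of_nat_choose_nonzero[OF prime char, of t "t + j"] lt by (simp add: a_def)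
    have "D div p = X1" unfolding D using lt by (simp only: mod_div_add_mult)
    moreover have "Y1 div p = Y2" "X1 div p = X2" unfolding Y1_def X1_def
      using lt by (simp_all only: mod_div_add_mult)
    moreover have "Y2 mod p = t" "X2 mod p = 3 * t + 2" unfolding Y2_def X2_def
      using lt by (simp_all only: mod_div_add_mult)
    ultimately show "of_nat (j + 3 * D choose D) = (0 :: 'a)"
      using choose_nonzeroD(2)[OF prime char, of a D] choose_nonzeroD(2)[OF prime char, of Y1 X1]
        choose_nonzeroD(1)[OF prime char, of Y2 X2] a_dig unfolding a_def[symmetric]
      by force
  qed
  obtain F where F: "small F" "\<And>x. f x = poly F x" using small_pow[of 1] by auto
  have F_pow: "small (F ^ m)" if "m \<le> 3 * t + 2" for m
    using that small_pow by (intro small_power[OF assms(1) F(1), of "3 * t + 2"]) (auto simp: F(2))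
  have "degree F = 0"
  proof (cases "F = 0")
    case False
    show ?thesis
    proof (rule digits_le_multiples_eq_0)
      show "2 * e < p" "e < 3 * t + 2" using t by auto
      show "digits_le p e R (m * degree F)" if "m \<le> 3 * t + 2" for m
        using F_pow[OF that] False by (rule small_power_degree)
    qed
  qed simp
  then obtain c where "F = [:c:]" using degree_eq_zeroE by blast
  hence "f 0 = f 1" using F(2) by simp
  thus False using assms(3) by (metis bij_is_inj injD zero_neq_one)
qed

text \<open>The \<open>k\<close>-th powers of \<open>S'\<close> would lie in \<open>b * S\<close>,
  with \<open>S\<close> the nonzero squares. As \<open>1\<close> is in \<open>S'\<close>,
  \<open>b\<close> is a square; but the odd power \<open>k\<close> of \<open>\<omega> ^ 3\<close> is
  not.\<close>

lemma not_affine: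
  assumes "h = 1" "odd k" "\<And>u v. v - u \<in> S \<longleftrightarrow> f v - f u \<in> S'" "surj f"
    "\<And>u v. (f v - f u) ^ k = b * (v - u)"
  shows False
proof -
  have dvd: "2 dvd q - 1" using odd_p by simp
  have *: "\<exists>j. \<omega> ^ (k * i) = b * \<omega> ^ (j * 2)" if "\<omega> ^ i \<in> S'" for i
  proof -
    obtain v where v: "f v = f 0 + \<omega> ^ i" using assms(4) by (metis surjD)
    hence "v - 0 \<in> S" using assms(3)[of v 0] that by simp
    moreover have "\<omega> ^ (k * i) = b * v" using assms(5)[of v 0] v by (simp add: mult.commute flip: power_mult)
    moreover have "S = power_subgroup 2" unfolding S_def by (simp add: assms(1))
    ultimately show ?thesis by (auto simp: power_subgroup_def)
  qed
  have S': "S' = power_subgroup 4 \<union> (\<lambda>s. \<omega> ^ 3 * s) ` power_subgroup 4"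
    unfolding S'_def by (simp add: assms(1))
  have one: "1 \<in> power_subgroup 4" by (auto simp: power_subgroup_def intro!: exI[of _ 0])
  hence "\<omega> ^ 0 \<in> S'" by (simp add: S')
  then obtain j where j: "1 = b * \<omega> ^ (j * 2)" using *[of 0] by auto
  have "\<omega> ^ 3 \<in> S'" using one by (force simp: S')
  then obtain i where i: "\<omega> ^ (k * 3) = b * \<omega> ^ (i * 2)" using * by blast
  have "\<omega> ^ (k * 3 + j * 2) = b * \<omega> ^ (j * 2) * \<omega> ^ (i * 2)" by (simp add: power_add i)
  hence "\<omega> ^ (k * 3 + j * 2) \<in> power_subgroup 2" using j by (auto simp: power_subgroup_def)
  hence "even (k * 3 + j * 2)" using prim_power_in_power_subgroup_iff[OF dvd] by blast
  thus False using assms(2) by simp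
qed

text \<open>With two digits, domination of \<open>D\<close> must fail in the lowest one, so
  \<open>j\<close> stops at \<open>e\<close> and \<open>degree F\<close> may have digits 1. The
  exponents with \<open>i = 1\<close> bring in \<open>f ^ p\<close> to settle those cases.\<close>

lemma not_iso_of_R_eq_2:
  assumes "h = 1" "R = 2" "p \<noteq> 3" "bij f" "\<And>u v. v - u \<in> S \<longleftrightarrow> f v - f u \<in> S'"
  shows False
proof -
  define t where "t = p div 4"
  note t = D_eq_of_h_1[OF assms(1) t_def]
  \<comment> \<open>This lets the second digit \<open>3 * t + 2\<close> of \<open>3 * D\<close> grow
    by 1 without a carry, which is impossible for \<open>p = 3\<close>.\<close>
  have t_pos: "t > 0" using assms(3) t(2) by (cases t) auto
  have D: "D = 3 * t + 2 + p * t" "3 * D = t + p * (3 * t + 2)" using t(3,4) assms(2) by simp_all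
  have small_pow: "\<exists>G. small G \<and> (\<forall>x. f x ^ (j + p * i) = poly G x)"
    if ij: "j \<le> 2 * t + 1" "i \<le> 1" for i j
  proof (rule iso_power_small[OF assms(1,4,5)])
    have "p * i \<le> p * t" using ij t_pos by (intro mult_left_mono) auto
    thus "j + p * i < D" unfolding D(1) using ij by linarith
    define a where "a = j + p * i + 3 * D"
    have lt: "t + j < p" "3 * t + 2 + i < p" "t < p" "3 * t + 2 < p" using ij t(2) t_pos by auto
    have a: "a = (t + j) + p * (3 * t + 2 + i)" unfolding a_def D(2) by (simp add: algebra_simps)
    have "a mod p = t + j" "a div p = 3 * t + 2 + i" "3 * D mod p = t" "3 * D div p = 3 * t + 2"
      unfolding a D(2) using lt by (simp_all only: mod_div_add_mult)
    hence "of_nat (a choose 3 * D) = (of_nat (3 * t + 2 + i choose (3 * t + 2)) * of_nat (t + j choose t) :: 'a)"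
      by (simp add: lucas_step[OF prime char, of a])
    thus "of_nat (j + p * i + 3 * D choose 3 * D) \<noteq> (0 :: 'a)"
      using of_nat_choose_nonzero[OF prime char, of t "t + j"] lt
        of_nat_choose_nonzero[OF prime char, of "3 * t + 2" "3 * t + 2 + i"] by (simp add: a_def)
    have "D mod p = 3 * t + 2" unfolding D(1) using lt by (simp only: mod_div_add_mult)
    thus "of_nat (j + p * i + 3 * D choose D) = (0 :: 'a)"
      using choose_nonzeroD(1)[OF prime char, of a D] \<open>a mod p = t + j\<close> ij unfolding a_def[symmetric]
      by force
  qed
  obtain F where F: "small F" "\<And>x. f x = poly F x" using small_pow[of 1 0] by auto
  obtain F' where F': "small F'" "\<And>x. f x ^ p = poly F' x" using small_pow[of 0 1] by auto
  obtain G where G: "small G" "\<And>x. f x ^ (e + p) = poly G x" using small_pow[of e 1] t(1) by auto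
  have F_pow: "small (F ^ m)" if "m \<le> e" for m
    using that small_pow[of _ 0] t(1) by (intro small_power[OF assms(1) F(1), of e]) (auto simp: F(2))
  have nonconst: "degree H \<noteq> 0" if "odd k" "\<And>x. f x ^ k = poly H x" for k H
  proof
    assume "degree H = 0"
    then obtain c where "H = [:c:]" using degree_eq_zeroE by blast
    hence c: "f x ^ k = c" for x using that by simp
    obtain x y where "f x = 0" "f y = 1" using assms(4) by (metis bij_is_surj surjD)
    moreover have "k > 0" using that(1) by (rule odd_pos)
    ultimately show False using c[of x] c[of y] by (simp add: power_0_left)
  qed
  have "F \<noteq> 0" "F' \<noteq> 0" using nonconst[of 1 F] nonconst[of p F'] F(2) F'(2) odd_p by auto
  have L: "degree F mod p \<le> 1" "degree F div p \<le> 1"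
    using digits_le_multiples_2[of e p "degree F"] small_power_degree[OF F_pow \<open>F \<noteq> 0\<close>] assms(2) t by auto
  show False
  proof (cases "degree F div p = 0")
    case True
    hence "degree F \<le> 1" using L by (metis div_mult_mod_eq mult_0 add_0)
    hence "degree F = 1" using nonconst[of 1 F] F(2) by simp
    then obtain a b where "F = [:a, b:]" by (metis degree1_coeffs)
    hence "(f v - f u) ^ 1 = b * (v - u)" for u v by (simp add: F(2) algebra_simps)
    thus False using not_affine[OF assms(1) _ assms(5), of 1] assms(4) by (auto simp: bij_is_surj)
  next
    case False
    hence L1: "degree F div p = 1" using L by simp
    have "F ^ e * F' = G"
      by (rule small_mult[OF assms(1) F_pow F'(1) G(1)]) (auto simp: F(2)[symmetric] F'(2)[symmetric] G(2)[symmetric] power_add)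
    moreover have "F ^ e * F' \<noteq> 0" using \<open>F \<noteq> 0\<close> \<open>F' \<noteq> 0\<close> by simp
    ultimately have "digits_le p e R (degree (F ^ e * F'))"
      using G(1) by (metis leading_coeff_0_iff small_def)
    moreover have "degree (F ^ e * F') = e * degree F + degree F'"
      using \<open>F \<noteq> 0\<close> \<open>F' \<noteq> 0\<close> by (simp add: degree_mult_eq degree_power_eq)
    ultimately have "digits_le p e (Suc 1) (e * degree F + degree F')"
      using assms(2) by (metis Suc_1)
    hence "digits_le p e 1 ((e * degree F + degree F') div p)" by (metis digits_le.simps(2))
    hence le: "(e * degree F + degree F') div p \<le> e" using digits_le_bound by fastforce
    \<comment> \<open>Otherwise, as \<open>degree F >= p\<close>, the quotient by \<open>p\<close>
      of the degree of \<open>F ^ e * F'\<close> would exceed \<open>e\<close>.\<close>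
    have d: "degree F' < p"
    proof (rule ccontr)
      assume "\<not> degree F' < p"
      moreover have "p \<le> degree F" using L1 by (metis div_less leI zero_neq_one)
      ultimately have "e * p + p \<le> e * degree F + degree F'"
        by (intro add_mono mult_left_mono) simp_all
      hence "(e + 1) * p \<le> e * degree F + degree F'" by simp
      hence "e + 1 \<le> (e * degree F + degree F') div p"
        using p_gt_1 by (subst less_eq_div_iff_mult_less_eq) simp_all
      thus False using le by simp
    qed
    \<comment> \<open>\<open>f ^ (p ^ 2) = f\<close> as functions, and the degree bound on
      \<open>F'\<close> excludes reduction. Hence \<open>degree F = p * degree F'\<close>, which
      forces \<open>F'\<close> to be linear.\<close>
    have "F' ^ p = F"
    proof (rule poly_eq_of_fun_eq)
      have "f x ^ p ^ 2 = f x" for x using power_q assms(2) by simp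
      thus "poly (F' ^ p) = poly F"
        by (simp add: fun_eq_iff power2_eq_square power_mult flip: F(2) F'(2))
      show "degree (F' ^ p) < q" using d p_gt_1 \<open>F' \<noteq> 0\<close> assms(2)
        by (simp add: degree_power_eq power2_eq_square)
      show "degree F < q" using small_degree[OF F(1)] four_h_D D_pos assms(1) by simp
    qed
    hence "degree F = p * degree F'" using \<open>F' \<noteq> 0\<close> by (auto simp: degree_power_eq)
    hence "degree F' = 1" using L1 p_gt_1 by simp
    then obtain a b where "F' = [:a, b:]" by (metis degree1_coeffs)
    hence lin: "f x ^ p = a + x * b" for x using F'(2) by simp
    have "(f v - f u) ^ p = b * (v - u)" for u v
    proof -
      have "(f v - f u) ^ p = f v ^ p - f u ^ p" using frobenius_add[of "f v - f u" "f u"] by simp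
      also have "\<dots> = b * (v - u)" unfolding lin by (simp add: algebra_simps)
      finally show ?thesis .
    qed
    thus False using not_affine[OF assms(1) odd_p assms(5)] assms(4) by (auto simp: bij_is_surj)
  qed
qed

section \<open>The exceptional isomorphism on nine vertices\<close>

text \<open>The unique \<open>\<F>\<^sub>3\<close>-linear map with \<open>1 \<mapsto> 1\<close> and \<open>\<omega>\<^sup>2 \<mapsto> \<omega>\<^sup>3\<close>, written as a linearised polynomial.\<close>

lemma iso_order_9:
  assumes "h = 1" "R = 2" "p = 3"
  shows "\<exists>f. bij f \<and> (\<forall>u v. v - u \<in> S \<longleftrightarrow> f v - f u \<in> S')"
proof -
  define f where "f x = (\<omega> - 1) * x ^ 3 - (1 + \<omega>) * x" for x :: 'a
  have three: "(3 :: 'a) = 0" using of_nat_eq_0_iff[of 3] assms(3) by simp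
  have "(q - 1) div 2 = 4" by (simp add: assms)
  hence w4: "\<omega> ^ 4 = - 1" using minus_1_eq[OF odd_p] by simp
  have w2: "\<omega> ^ 2 \<noteq> - 1" 
  proof
    assume "\<omega> ^ 2 = - 1"
    hence "(\<omega> ^ 2) ^ 2 = 1" by simp
    hence "\<omega> ^ 4 = 1" by (simp flip: power_mult)
    thus False using assms prim_power_eq_1_iff[of 4] by simp
  qed
  have cube: "(x + y) ^ 3 = x ^ 3 + y ^ 3" for x y :: 'a
    using frobenius_add[of x y] by (simp only: assms(3))
  have add: "f (x + y) = f x + f y" for x y by (simp add: f_def cube algebra_simps)
  have f0: "f 0 = 0" by (simp add: f_def)
  have neg: "f (- x) = - f x" for x using add[of x "- x"] f0 by (simp add: eq_neg_iff_add_eq_0 add.commute)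
  have diff: "f (x - y) = f x - f y" for x y using add[of x "- y"] neg by simp
  have "f 1 = 1 - 3" by (simp add: f_def)
  hence f1: "f 1 = 1" by (simp add: three)
  have "f (\<omega> ^ 2) = \<omega> ^ 3 * (\<omega> ^ 4 - 1) - \<omega> ^ 2 * (\<omega> ^ 4 + 1)" by (simp add: f_def algebra_simps flip: power_mult power_Suc power_Suc2 power_add)
  also have "\<dots> = \<omega> ^ 3 * (1 - 3)" by (simp add: w4)
  finally have f2: "f (\<omega> ^ 2) = \<omega> ^ 3" by (simp add: three)
  \<comment> \<open>A nonzero root satisfies \<open>(\<omega> - 1) * x ^ 2 = 1 + \<omega>\<close>.
    Taking fourth powers, with \<open>x ^ 8 = 1\<close>, gives
    \<open>- (\<omega> + \<omega> ^ 3) = \<omega> + \<omega> ^ 3\<close>, hence the excluded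
    \<open>\<omega> ^ 2 = - 1\<close>.\<close>
  have ker: "x = 0" if "f x = 0" for x
  proof (rule ccontr)
    assume x: "x \<noteq> 0"
    have "x * ((\<omega> - 1) * x ^ 2 - (1 + \<omega>)) = 0" using that by (simp add: f_def algebra_simps power2_eq_square power3_eq_cube)
    hence "(\<omega> - 1) * x ^ 2 = 1 + \<omega>" using x by simp
    hence "((\<omega> - 1) * x ^ 2) ^ 4 = (1 + \<omega>) ^ 4" by simp
    moreover have "x ^ 8 = 1" using power_q_minus_1[OF x] assms by simp
    ultimately have eq: "(\<omega> - 1) ^ 4 = (1 + \<omega>) ^ 4" by (simp add: power_mult_distrib flip: power_mult)
    have "(1 + \<omega>) ^ 4 = (1 + \<omega>) * (1 + \<omega> ^ 3)" using cube[of 1 \<omega>] by (simp add: power4_eq_xxxx power3_eq_cube mult.assoc)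
    also have "\<dots> = \<omega> + \<omega> ^ 3 + (1 + \<omega> ^ 4)" by (simp add: algebra_simps flip: power_Suc)
    finally have A: "(1 + \<omega>) ^ 4 = \<omega> + \<omega> ^ 3" by (simp add: w4)
    have "(\<omega> - 1) ^ 4 = (\<omega> - 1) * (\<omega> ^ 3 - 1)" using cube[of \<omega> "- 1"] by (simp add: power4_eq_xxxx power3_eq_cube mult.assoc)
    also have "\<dots> = - (\<omega> + \<omega> ^ 3) + (1 + \<omega> ^ 4)" by (simp add: algebra_simps flip: power_Suc)
    finally have B: "(\<omega> - 1) ^ 4 = - (\<omega> + \<omega> ^ 3)" by (simp add: w4)
    have "(\<omega> + \<omega> ^ 3) + (\<omega> + \<omega> ^ 3) = 0" using eq A B by (metis add.right_inverse)
    hence "(3 - 1) * (\<omega> + \<omega> ^ 3) = 0" by (simp add: algebra_simps)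
    hence "\<omega> + \<omega> ^ 3 = 0"
      by (metis three mult_eq_0_iff diff_0 neg_equal_0_iff_equal zero_neq_one)
    moreover have "\<omega> * (1 + \<omega> ^ 2) = \<omega> + \<omega> ^ 3"
      by (simp add: algebra_simps power2_eq_square power3_eq_cube)
    ultimately have "\<omega> * (1 + \<omega> ^ 2) = 0" by simp
    hence "\<omega> ^ 2 = - 1" using prim_nonzero by (simp add: eq_neg_iff_add_eq_0 add.commute)
    thus False using w2 by blast
  qed
  have "inj f" using ker diff by (intro injI) (metis right_minus_eq)
  hence bij: "bij f" by (simp add: finite_UNIV_inj_surj bij_def)
  have S: "S = {1, \<omega> ^ 2, - 1, - (\<omega> ^ 2)}"
  proof -
    have "S = (\<lambda>j. \<omega> ^ (j * 2)) ` {..<4}"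
      unfolding S_def using power_subgroup_eq_image(1)[of 2 4] by (simp add: assms)
    also have "{..<4} = {0, 1, 2, 3 :: nat}" by auto
    also have "(\<lambda>j. \<omega> ^ (j * 2)) ` {0, 1, 2, 3 :: nat} = {1, \<omega> ^ 2, \<omega> ^ 4, \<omega> ^ 4 * \<omega> ^ 2}"
      by (simp flip: power_add)
    finally show ?thesis by (simp add: w4)
  qed
  have S': "S' = {1, - 1, \<omega> ^ 3, - (\<omega> ^ 3)}"
  proof -
    have "power_subgroup 4 = (\<lambda>j. \<omega> ^ (j * 4)) ` {..<2}"
      using power_subgroup_eq_image(1)[of 4 2] by (simp add: assms)
    also have "{..<2} = {0, 1 :: nat}" by auto
    finally have "power_subgroup 4 = {1, - 1}" by (simp add: w4)
    moreover have "S' = power_subgroup 4 \<union> (\<lambda>s. \<omega> ^ 3 * s) ` power_subgroup 4"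
      unfolding S'_def by (simp add: assms(1))
    ultimately show ?thesis by auto
  qed
  have "f ` S = S'" by (auto simp: S S' f1 f2 neg)
  hence "x \<in> S \<longleftrightarrow> f x \<in> S'" for x using \<open>inj f\<close> by (metis inj_image_mem_iff)
  thus ?thesis using bij diff by metis
qed

end

theorem theorem7p16:
  fixes p R h :: nat and \<omega> :: "'a::{field,finite}"
  assumes "prime p" and "[p = 3] (mod 4)"
    and "R \<ge> 2" and "even R"
    and "h > 0" and "odd h" and "2 * h dvd p - 1"
    and "CARD('a) = p ^ R" and "primitive_element \<omega>"
  shows "((R, p, h) \<noteq> (2, 3, 1) \<longrightarrow> \<not> ugraph_iso (GPaley \<omega> (2 * h)) (TGPaley \<omega> h)) \<and>
         ((R, p, h) = (2, 3, 1) \<longrightarrow> ugraph_iso (GPaley \<omega> (2 * h)) (TGPaley \<omega> h))"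
proof -
  interpret twisted_paley p R \<omega> h
    using assms by unfold_locales (auto simp: cong_def)
  have "(R, p, h) = (2, 3, 1)" if "bij f" "\<And>u v. v - u \<in> S \<longleftrightarrow> f v - f u \<in> S'" for f
  proof -
    have "\<not> h \<ge> 3" using not_iso_of_h_ge_3 that by blast
    moreover have "h \<noteq> 2" using assms(6) by auto
    ultimately have "h = 1" using assms(5) by linarith
    moreover from this have "\<not> R \<ge> 4" using not_iso_of_R_ge_4 that by blast
    moreover have "R \<noteq> 3" using assms(4) by auto
    ultimately have "R = 2" using assms(3) by linarith
    moreover from this have "p = 3" using not_iso_of_R_eq_2 that \<open>h = 1\<close> by blast
    ultimately show ?thesis using \<open>h = 1\<close> by simp
  qed
  hence "ugraph_iso (GPaley \<omega> (2 * h)) (TGPaley \<omega> h) \<Longrightarrow> (R, p, h) = (2, 3, 1)"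
    unfolding ugraph_iso_iff by blast
  moreover have "(R, p, h) = (2, 3, 1) \<Longrightarrow> ugraph_iso (GPaley \<omega> (2 * h)) (TGPaley \<omega> h)"
    unfolding ugraph_iso_iff using iso_order_9 by blast
  ultimately show ?thesis by blast
qed

end
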